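(* Let $F$ be a non-archimedean local field, $G=\mathrm{PGL}(2,F)$, and let $(\pi,\mathcal V)$ be an irreducible smooth complex representation of $G$ which has no non-zero vector fixed by $\Gamma_0(\mathfrak p^0)$ and which is generic. Let $\tilde\Psi_\pi:\tilde{\mathcal V}\to C^1(\tilde X_{n(\pi)},\mathbb C)$ be the $G$-equivariant map $\tilde\Psi_\pi(\varphi)(a)=\varphi(v_a)$, $a\in\tilde X^1_{n(\pi)}$. Then: i) the image of $\tilde\Psi_\pi$ lies in $\mathcal H_\infty(\tilde X_{n(\pi)},\mathbb C)$; ii) the map $\tilde\Psi_\pi$ is injective.
   Context: Let $\mathfrak o$ be the ring of integers of $F$ and $\mathfrak p$ its maximal ideal. $\Gamma_0(\mathfrak p^0)$ is the image of $\mathrm{GL}(2,\mathfrak o)$ in $G$; for $n\ge 1$, $\Gamma_0(\mathfrak p^n)$ is the image in $G$ of the group of matrices $\begin{pmatrix}a&b\\c&d\end{pmatrix}$ with $a,d\in\mathfrak o^\times$, $b\in\mathfrak o$, $c\in\mathfrak p^n$. "Generic" means: $\pi$ is not of the form $\chi\circ\det$ with $\chi$ a character of $F^\times/(F^\times)^2$, where $\det:G\to F^\times/(F^\times)^2$ is induced by the determinant. $\tilde{\mathcal V}$ is the contragredient (smooth dual) of $\mathcal V$. Under these assumptions on $\pi$ (Casselman), there is an integer $n(\pi)\ge 0$ with $\mathcal V^{\Gamma_0(\mathfrak p^{n(\pi)+1})}\ne 0$ and $\mathcal V^{\Gamma_0(\mathfrak p^{n(\pi)})}=0$, and $\mathcal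 V^{\Gamma_0(\mathfrak p^{n(\pi)+1})}$ is one-dimensional. Let $X$ be the Bruhat-Tits tree of $G$. For $k\ge 0$, a $k$-path in $X$ is an injective sequence $(s_0,\dots,s_k)$ of vertices with $\{s_i,s_{i+1}\}$ an edge of $X$ for $0\le i\le k-1$. The directed graph $\tilde X_k$ has as vertex set $\tilde X_k^0$ the set of $k$-paths and as edge set $\tilde X_k^1$ the set of $(k+1)$-paths; the edge $a=(t_0,\dots,t_{k+1})$ has head $a^+=(t_1,\dots,t_{k+1})$ and tail $a^-=(t_0,\dots,t_k)$. $G$ acts on $\tilde X_k$, transitively on $\tilde X_k^1$. The group $\Gamma_0(\mathfrak p^{n(\pi)+1})$ is the stabilizer in $G$ of some edge of $\tilde X_{n(\pi)}$; fix such an edge $a_o$. Fix a non-zero $v_o\in\mathcal V^{\Gamma_0(\mathfrak p^{n(\pi)+1})}$, and for an edge $a=ga_o$ ($g\in G$) put $v_a=gv_o$ (independent of the choice of $g$). $C^1(\tilde X_k,\mathbb C)$ is the space of complex functions on $\tilde X_k^1$. With $[a:a^+]=1$, $[a:a^-]=-1$, set $d^*f(s)=\sum_{a\ni s}[a:s]f(a)$ for $f\in C^1(\tilde X_k,\mathbb C)$, $s\in\tilde X_k^0$ (sum over edges $a$ having $s$ as head or tail). $\mathcal H(\tilde X_k,\mathbb C)=\ker d^*$ is the space of harmonic forms, and $\mathcal H_\infty(\tilde X_k,\mathbb C)$ is its subspace of smooth vectors (those fixed by an open subgroup of $G$). *)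

theory Defs
  imports "HOL-Analysis.Analysis" "HOL-Algebra.Coset"
begin

section \<open>Non-archimedean local fields\<close>

text \<open>
  The absolute value of \<open>x\<close> is \<open>dist x 0\<close>.  Local compactness is required at \<open>0\<close> only; it follows
  everywhere by translation.  A field with a non-trivial ultrametric absolute value
  for which it is locally compact is automatically complete and discretely valued, with finite
  residue field.
\<close>

class nonarch_local_field = field + metric_space +
  assumes dist_translate: "dist (x + z) (y + z) = dist x y"
    and dist_mult_zero: "dist (x * y) 0 = dist x 0 * dist y 0"
    and dist_ultrametric: "dist x z \<le> max (dist x y) (dist y z)"
    and dist_nontrivial: "\<exists>x. x \<noteq> 0 \<and> dist x 0 \<noteq> 1"
    and compact_ball_zero: "\<exists>e>0. compact {x. dist x 0 \<le> e}"

definition int_ring :: "'f::nonarch_local_field set" where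
  "int_ring = {x. dist x 0 \<le> 1}"

definition int_units :: "'f::nonarch_local_field set" where
  "int_units = {x \<in> int_ring. \<exists>y\<in>int_ring. x * y = 1}"

definition max_ideal :: "'f::nonarch_local_field set" where
  "max_ideal = {x. dist x 0 < 1}"

fun max_ideal_pow :: "nat \<Rightarrow> 'f::nonarch_local_field set" where
  "max_ideal_pow 0 = int_ring"
| "max_ideal_pow (Suc n) =
     {\<Sum>i<m. x i * y i | (m::nat) x y. \<forall>i<m. x i \<in> max_ideal \<and> y i \<in> max_ideal_pow n}"


section \<open>The group \<open>PGL(2,F)\<close>\<close>

definition GL2 :: "('f::field ^ 2 ^ 2) monoid" where
  "GL2 = \<lparr>carrier = {A. invertible A}, mult = (**), one = mat 1\<rparr>"

definition scalars :: "('f::field ^ 2 ^ 2) set" where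
  "scalars = {mat c | c. c \<noteq> 0}"

definition PGL2 :: "('f::field ^ 2 ^ 2) set monoid" where
  "PGL2 = GL2 Mod scalars"

definition to_PGL2 :: "'f::field ^ 2 ^ 2 \<Rightarrow> ('f ^ 2 ^ 2) set" where
  "to_PGL2 A = scalars #>\<^bsub>GL2\<^esub> A"

text \<open>
  Openness in \<open>PGL(2,F)\<close> is that of the quotient topology, \<open>GL(2,F)\<close> being a subspace of the space
  of matrices; the preimage in \<open>GL(2,F)\<close> of a set \<open>U\<close> of cosets is \<open>\<Union>U\<close>.
\<close>

definition open_subgroup :: "('f::nonarch_local_field ^ 2 ^ 2) set set \<Rightarrow> bool" where
  "open_subgroup K \<longleftrightarrow> subgroup K PGL2 \<and> openin (top_of_set (carrier GL2)) (\<Union>K)"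

definition GL2_int :: "('f::nonarch_local_field ^ 2 ^ 2) set" where
  "GL2_int = {A. (\<forall>i j. A $ i $ j \<in> int_ring) \<and> det A \<in> int_units}"

definition Gamma0 :: "nat \<Rightarrow> ('f::nonarch_local_field ^ 2 ^ 2) set set" where
  "Gamma0 n =
     to_PGL2 ` (if n = 0 then GL2_int
       else {A. A $ 1 $ 1 \<in> int_units \<and> A $ 2 $ 2 \<in> int_units \<and>
                A $ 1 $ 2 \<in> int_ring \<and> A $ 2 $ 1 \<in> max_ideal_pow n})"


section \<open>The Bruhat-Tits tree and its path graphs\<close>

definition is_lattice :: "('f::nonarch_local_field ^ 2) set \<Rightarrow> bool" where
  "is_lattice L \<longleftrightarrow> (\<exists>u v. u \<noteq> v \<and> vec.independent {u, v} \<and>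
     L = {a *s u + b *s v | a b. a \<in> int_ring \<and> b \<in> int_ring})"

definition homothety_class :: "('f::field ^ 2) set \<Rightarrow> ('f ^ 2) set set" where
  "homothety_class L = {(\<lambda>x. c *s x) ` L | c. c \<noteq> 0}"

definition tree_vertices :: "('f::nonarch_local_field ^ 2) set set set" where
  "tree_vertices = {homothety_class L | L. is_lattice L}"

text \<open>As the maximal ideal is principal, the products of its elements with elements of a lattice
  \<open>L\<close> already form a submodule of \<open>L\<close>.\<close>

definition tree_adj ::
  "('f::nonarch_local_field ^ 2) set set \<Rightarrow> ('f ^ 2) set set \<Rightarrow> bool" where
  "tree_adj s t \<longleftrightarrow> (\<exists>L\<in>s. \<exists>M\<in>t. {c *s x | c x. c \<in> max_ideal \<and> x \<in> L} \<subset> M \<and> M \<subset> L)"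

definition paths :: "nat \<Rightarrow> ('f::nonarch_local_field ^ 2) set set list set" where
  "paths k = {p. length p = Suc k \<and> set p \<subseteq> tree_vertices \<and> distinct p \<and>
     (\<forall>i<k. tree_adj (p ! i) (p ! Suc i))}"

definition graph_verts :: "nat \<Rightarrow> ('f::nonarch_local_field ^ 2) set set list set" where
  "graph_verts k = paths k"

definition graph_edges :: "nat \<Rightarrow> ('f::nonarch_local_field ^ 2) set set list set" where
  "graph_edges k = paths (Suc k)"

definition edge_head :: "'s list \<Rightarrow> 's list" where
  "edge_head a = tl a"

definition edge_tail :: "'s list \<Rightarrow> 's list" where
  "edge_tail a = butlast a"

definition act_vertex ::
  "('f::field ^ 2 ^ 2) set \<Rightarrow> ('f ^ 2) set set \<Rightarrow> ('f ^ 2) set set" where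
  "act_vertex g s = {(\<lambda>x. A *v x) ` L | A L. A \<in> g \<and> L \<in> s}"

definition act_path ::
  "('f::field ^ 2 ^ 2) set \<Rightarrow> ('f ^ 2) set set list \<Rightarrow> ('f ^ 2) set set list" where
  "act_path g p = map (act_vertex g) p"

definition edge_stabilizer ::
  "('f::field ^ 2) set set list \<Rightarrow> ('f ^ 2 ^ 2) set set" where
  "edge_stabilizer a = {g \<in> carrier PGL2. act_path g a = a}"


section \<open>Smooth representations of \<open>PGL(2,F)\<close>\<close>

definition smooth_vector ::
  "(('f::nonarch_local_field ^ 2 ^ 2) set \<Rightarrow> 'x \<Rightarrow> 'x) \<Rightarrow> 'x \<Rightarrow> bool" where
  "smooth_vector act x \<longleftrightarrow> (\<exists>K. open_subgroup K \<and> (\<forall>k\<in>K. act k x = x))"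

definition is_rep ::
  "(complex \<Rightarrow> 'v::ab_group_add \<Rightarrow> 'v) \<Rightarrow> (('f::field ^ 2 ^ 2) set \<Rightarrow> 'v \<Rightarrow> 'v) \<Rightarrow> bool" where
  "is_rep smul \<pi> \<longleftrightarrow> vector_space smul \<and>
     (\<forall>g\<in>carrier PGL2. Vector_Spaces.linear smul smul (\<pi> g)) \<and>
     \<pi> \<one>\<^bsub>PGL2\<^esub> = id \<and>
     (\<forall>g\<in>carrier PGL2. \<forall>h\<in>carrier PGL2. \<pi> (g \<otimes>\<^bsub>PGL2\<^esub> h) = \<pi> g \<circ> \<pi> h)"

definition is_smooth_rep ::
  "(complex \<Rightarrow> 'v::ab_group_add \<Rightarrow> 'v) \<Rightarrow>
   (('f::nonarch_local_field ^ 2 ^ 2) set \<Rightarrow> 'v \<Rightarrow> 'v) \<Rightarrow> bool" where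
  "is_smooth_rep smul \<pi> \<longleftrightarrow> is_rep smul \<pi> \<and> (\<forall>v. smooth_vector \<pi> v)"

definition is_irreducible ::
  "(complex \<Rightarrow> 'v::ab_group_add \<Rightarrow> 'v) \<Rightarrow> (('f::field ^ 2 ^ 2) set \<Rightarrow> 'v \<Rightarrow> 'v) \<Rightarrow> bool" where
  "is_irreducible smul \<pi> \<longleftrightarrow> (UNIV :: 'v set) \<noteq> {0} \<and>
     (\<forall>W. module.subspace smul W \<and> (\<forall>g\<in>carrier PGL2. \<pi> g ` W \<subseteq> W) \<longrightarrow> W = {0} \<or> W = UNIV)"

definition fixed_vectors ::
  "(('f::field ^ 2 ^ 2) set \<Rightarrow> 'v \<Rightarrow> 'v) \<Rightarrow> ('f ^ 2 ^ 2) set set \<Rightarrow> 'v set" where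
  "fixed_vectors \<pi> K = {v. \<forall>k\<in>K. \<pi> k v = v}"

definition mult_group :: "'k::field monoid" where
  "mult_group = \<lparr>carrier = UNIV - {0}, mult = (*), one = 1\<rparr>"

definition squares :: "'k::field set" where
  "squares = {x\<^sup>2 | x. x \<noteq> 0}"

text \<open>Continuity refers to the quotient topology on \<open>F\<^sup>\<times> / (F\<^sup>\<times>)\<^sup>2\<close>.\<close>

definition is_square_class_character :: "('f::nonarch_local_field set \<Rightarrow> complex) \<Rightarrow> bool" where
  "is_square_class_character \<omega> \<longleftrightarrow>
     \<omega> \<in> hom (mult_group Mod squares) mult_group \<and>
     continuous_on (UNIV - {0}) (\<lambda>x. \<omega> (squares #>\<^bsub>mult_group\<^esub> x))"

text \<open>The determinants of the representatives of an element of \<open>PGL(2,F)\<close> form exactly one coset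
  of \<open>(F\<^sup>\<times>)\<^sup>2\<close>, because \<open>det (c A) = c\<^sup>2 det A\<close>.\<close>

definition det_class :: "('f::field ^ 2 ^ 2) set \<Rightarrow> 'f set" where
  "det_class g = det ` g"

definition is_generic ::
  "(complex \<Rightarrow> 'v::ab_group_add \<Rightarrow> 'v) \<Rightarrow>
   (('f::nonarch_local_field ^ 2 ^ 2) set \<Rightarrow> 'v \<Rightarrow> 'v) \<Rightarrow> bool" where
  "is_generic smul \<pi> \<longleftrightarrow>
     \<not> (vector_space.dim smul (UNIV :: 'v set) = 1 \<and>
        (\<exists>\<omega>. is_square_class_character \<omega> \<and>
             (\<forall>g\<in>carrier PGL2. \<forall>v. \<pi> g v = smul (\<omega> (det_class g)) v)))"

definition dual_action ::
  "(('f::field ^ 2 ^ 2) set \<Rightarrow> 'v \<Rightarrow> 'v) \<Rightarrow> ('f ^ 2 ^ 2) set \<Rightarrow> ('v \<Rightarrow> complex) \<Rightarrow> 'v \<Rightarrow> complex" where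
  "dual_action \<pi> g \<phi> = (\<lambda>v. \<phi> (\<pi> (inv\<^bsub>PGL2\<^esub> g) v))"

definition contragredient ::
  "(complex \<Rightarrow> 'v::ab_group_add \<Rightarrow> 'v) \<Rightarrow>
   (('f::nonarch_local_field ^ 2 ^ 2) set \<Rightarrow> 'v \<Rightarrow> 'v) \<Rightarrow> ('v \<Rightarrow> complex) set" where
  "contragredient smul \<pi> =
     {\<phi>. Vector_Spaces.linear smul (*) \<phi> \<and> smooth_vector (dual_action \<pi>) \<phi>}"

text \<open>The spaces of fixed vectors increase with \<open>n\<close>, so at most one \<open>n\<close> qualifies; for generic
  irreducible \<open>\<pi>\<close> without non-zero vectors fixed by \<open>Gamma0 0\<close> it exists by Casselman's theorem.\<close>

definition n_of ::
  "(('f::nonarch_local_field ^ 2 ^ 2) set \<Rightarrow> 'v::ab_group_add \<Rightarrow> 'v) \<Rightarrow> nat" where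
  "n_of \<pi> = (THE n. fixed_vectors \<pi> (Gamma0 (n + 1)) \<noteq> {0} \<and> fixed_vectors \<pi> (Gamma0 n) = {0})"


section \<open>Harmonic forms\<close>

text \<open>Functions on the edges are total functions vanishing off the edge set.\<close>

definition edge_cochains ::
  "nat \<Rightarrow> (('f::nonarch_local_field ^ 2) set set list \<Rightarrow> complex) set" where
  "edge_cochains k = {f. \<forall>a. a \<notin> graph_edges k \<longrightarrow> f a = 0}"

definition incidence :: "'s list \<Rightarrow> 's list \<Rightarrow> complex" where
  "incidence a s = (if s = edge_head a then 1 else if s = edge_tail a then -1 else 0)"

definition dstar ::
  "nat \<Rightarrow> (('f::nonarch_local_field ^ 2) set set list \<Rightarrow> complex) \<Rightarrow>
   ('f ^ 2) set set list \<Rightarrow> complex" where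
  "dstar k f s =
     (\<Sum>a | a \<in> graph_edges k \<and> (edge_head a = s \<or> edge_tail a = s). incidence a s * f a)"

definition harmonic_forms ::
  "nat \<Rightarrow> (('f::nonarch_local_field ^ 2) set set list \<Rightarrow> complex) set" where
  "harmonic_forms k = {f \<in> edge_cochains k. \<forall>s\<in>graph_verts k. dstar k f s = 0}"

definition cochain_action ::
  "nat \<Rightarrow> ('f::nonarch_local_field ^ 2 ^ 2) set \<Rightarrow> (('f ^ 2) set set list \<Rightarrow> complex) \<Rightarrow>
   ('f ^ 2) set set list \<Rightarrow> complex" where
  "cochain_action k g f =
     (\<lambda>a. if a \<in> graph_edges k then f (act_path (inv\<^bsub>PGL2\<^esub> g) a) else 0)"

definition smooth_harmonic_forms ::
  "nat \<Rightarrow> (('f::nonarch_local_field ^ 2) set set list \<Rightarrow> complex) set" where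
  "smooth_harmonic_forms k = {f \<in> harmonic_forms k. smooth_vector (cochain_action k) f}"

definition edge_vector ::
  "(('f::field ^ 2 ^ 2) set \<Rightarrow> 'v \<Rightarrow> 'v) \<Rightarrow> ('f ^ 2) set set list \<Rightarrow> 'v \<Rightarrow>
   ('f ^ 2) set set list \<Rightarrow> 'v" where
  "edge_vector \<pi> a\<^sub>o v\<^sub>o a = (THE v. \<exists>g\<in>carrier PGL2. a = act_path g a\<^sub>o \<and> v = \<pi> g v\<^sub>o)"

definition Psi ::
  "(('f::nonarch_local_field ^ 2 ^ 2) set \<Rightarrow> 'v::ab_group_add \<Rightarrow> 'v) \<Rightarrow>
   ('f ^ 2) set set list \<Rightarrow> 'v \<Rightarrow> ('v \<Rightarrow> complex) \<Rightarrow> ('f ^ 2) set set list \<Rightarrow> complex" where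
  "Psi \<pi> a\<^sub>o v\<^sub>o \<phi> =
     (\<lambda>a. if a \<in> graph_edges (n_of \<pi>) then \<phi> (edge_vector \<pi> a\<^sub>o v\<^sub>o a) else 0)"

end

(* A vector of \<pi> that is fixed by Gamma0 m for some m, when there is none for m = 0, already yields
   the minimal level, so n_of is meaningful without Casselman's theorem.  For a path s of length
   n_of \<pi>, the vectors v_a of the edges a with tail s (or with head s) are permuted by the stabilizer
   of s.  By transitivity on paths it contains a conjugate of Gamma0 (n_of \<pi>), so the sum of
   these vectors vanishes: this gives harmonicity.  Injectivity holds because the vectors on which
   two forms agree along the whole orbit form an invariant subspace containing v_o. *)

theory Submission
  imports Defs
begin

section \<open>The valuation ring\<close>

text \<open>The main labour is transitivity on paths, carried out with matrices. A vertex is the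
  class of the lattice spanned by the columns of an invertible matrix, and right multiplication by
  \<open>GL2_int\<close> or by a nonzero scalar does not move it. A path of length k is brought to
  the standard path by induction on k: elements of \<open>gamma0_mat k\<close> fix the standard
  path, and this freedom in the choice of the translating matrix is exactly what brings the next
  vertex into standard position. Neighbours of a vertex are parametrized by all integral slopes x,
  with repetitions, instead of by residue classes, so residues are never counted. Accordingly
  \<open>dstar\<close> is treated by cases: a finite set of edges is permuted by a stabilizer, while
  a sum over an infinite set has the value 0 by convention. Stabilizers enter in two ways. For paths
  of length n it is used that the stabilizer contains a conjugate of \<open>Gamma0 n\<close>; for
  the base edge, the hypothesis on its stabilizer makes the edge vectors well defined.\<close>

context
  fixes x y z :: "'f::nonarch_local_field"
begin

lemma dist_diff_zero: "dist x y = dist (x - y) (0::'f)"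
  using dist_translate[of "x - y" y 0] by simp

lemma abs_add: "dist (x + y) 0 \<le> max (dist x 0) (dist y 0)"
  using dist_ultrametric[of "x + y" 0 y] dist_translate[of x y 0] by simp

lemma abs_one [simp]: "dist (1::'f) 0 = 1"
  using dist_mult_zero[of "1::'f" 1] by simp

lemma abs_minus [simp]: "dist (- x) 0 = dist x 0"
  using dist_translate[of "- x" x 0] by (simp add: dist_commute)

lemma abs_diff: "dist (x - y) 0 \<le> max (dist x 0) (dist y 0)"
  using dist_ultrametric[of x y 0] by (simp add: dist_commute dist_diff_zero)

lemma abs_power: "dist (x ^ n) 0 = dist x 0 ^ n"
  by (induction n) (auto simp: dist_mult_zero)

lemma abs_inverse: "dist (inverse x) 0 = inverse (dist x 0)"
proof (cases "x = 0")
  case False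
  then have "dist x 0 * dist (inverse x) 0 = 1"
    using dist_mult_zero[of x "inverse x"] by simp
  then show ?thesis
    by (simp add: inverse_unique)
qed simp

end

lemma abs_divide: "dist (x / y) 0 = dist x 0 / dist (y::'f::nonarch_local_field) 0"
  by (simp add: divide_inverse dist_mult_zero abs_inverse)

lemma int_ring_iff: "x \<in> int_ring \<longleftrightarrow> dist x 0 \<le> 1"
  by (simp add: int_ring_def)

lemma int_ring_0 [simp]: "0 \<in> int_ring" and int_ring_1 [simp]: "1 \<in> int_ring"
  by (simp_all add: int_ring_iff)

lemma int_ring_add: "x \<in> int_ring \<Longrightarrow> y \<in> int_ring \<Longrightarrow> x + y \<in> int_ring"
  using abs_add[of x y] by (auto simp: int_ring_iff)

lemma int_ring_diff: "x \<in> int_ring \<Longrightarrow> y \<in> int_ring \<Longrightarrow> x - y \<in> int_ring"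
  using abs_diff[of x y] by (auto simp: int_ring_iff)

lemma int_ring_mult: "x \<in> int_ring \<Longrightarrow> y \<in> int_ring \<Longrightarrow> x * y \<in> int_ring"
  by (auto simp: int_ring_iff dist_mult_zero intro: mult_le_one)

lemma int_ring_power: "x \<in> int_ring \<Longrightarrow> x ^ n \<in> int_ring"
  by (induction n) (auto intro: int_ring_mult)

lemma int_units_iff: "x \<in> int_units \<longleftrightarrow> dist x 0 = 1"
proof
  assume "x \<in> int_units"
  then obtain y where "x \<in> int_ring" "y \<in> int_ring" "x * y = 1"
    unfolding int_units_def by blast
  then have y: "dist x 0 \<le> 1" "dist y 0 \<le> 1" "dist x 0 * dist y 0 = 1"
    by (simp_all add: int_ring_iff flip: dist_mult_zero)
  then have "1 \<le> dist x 0"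
    using mult_left_le[of "dist y 0" "dist x 0"] by simp
  then show "dist x 0 = 1"
    using y by simp
next
  assume x: "dist x 0 = 1"
  then have "x \<noteq> 0"
    by auto
  then have "x * inverse x = 1"
    by simp
  moreover have "inverse x \<in> int_ring"
    by (simp add: int_ring_iff abs_inverse x)
  ultimately show "x \<in> int_units"
    using x unfolding int_units_def by (auto simp: int_ring_iff)
qed

section \<open>Compactness and principality of the maximal ideal\<close>

lemma max_ideal_nontrivial: "\<exists>x::'f::nonarch_local_field. x \<noteq> 0 \<and> dist x 0 < 1"
proof -
  obtain x :: 'f where x: "x \<noteq> 0" "dist x 0 \<noteq> 1"
    using dist_nontrivial by blast
  show ?thesis
  proof (cases "dist x 0 < 1")
    case False
    then have "dist (inverse x) 0 < 1"
      using x by (simp add: abs_inverse inverse_less_1_iff)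
    with x show ?thesis
      by (intro exI[of _ "inverse x"]) simp
  qed (use x in blast)
qed

text \<open>Local compactness provides only some compact ball around 0, possibly a small one.
  Multiplication by a sufficiently small nonzero \<open>y\<close> carries the maximal ideal into it,
  so the ideal is a closed subset of a dilated compact ball.\<close>

lemma compact_max_ideal: "compact (max_ideal :: 'f::nonarch_local_field set)"
proof -
  obtain e where e: "e > 0" "compact {x::'f. dist x 0 \<le> e}"
    using compact_ball_zero by blast
  obtain t :: 'f where t: "t \<noteq> 0" "dist t 0 < 1"
    using max_ideal_nontrivial by blast
  obtain n where n: "dist t 0 ^ n < e"
    using real_arch_pow_inv[OF e(1) t(2)] by blast
  define y where "y = t ^ n"
  have y: "y \<noteq> 0" "dist y 0 < e"
    using t n by (auto simp: y_def abs_power)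
  have scale: "dist (inverse y * a) (inverse y * b) = inverse (dist y 0) * dist a b" for a b :: 'f
  proof -
    have "dist (inverse y * a) (inverse y * b) = dist (inverse y * (a - b)) 0"
      by (subst dist_diff_zero) (simp add: right_diff_distrib)
    then show ?thesis
      by (simp add: dist_mult_zero abs_inverse flip: dist_diff_zero)
  qed
  have cont: "continuous_on UNIV ((*) (inverse y))"
  proof (rule continuous_onI)
    fix x :: 'f and \<epsilon> :: real
    assume "\<epsilon> > 0"
    then show "\<exists>d>0. \<forall>x'\<in>UNIV. dist x' x < d \<longrightarrow> dist (inverse y * x') (inverse y * x) \<le> \<epsilon>"
      using y unfolding scale by (intro exI[of _ "\<epsilon> * dist y 0"]) (auto simp: field_simps)
  qed
  have "compact ((*) (inverse y) ` {x. dist x 0 \<le> e})"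
    using e(2) cont continuous_on_subset by (blast intro: compact_continuous_image)
  moreover have "closed (max_ideal :: 'f set)"
  proof -
    \<comment> \<open>If |x| is at least 1 and z is at distance less than 1 from x, the ultrametric
      inequality forces |z| to be at least 1 as well.\<close>
    have "open (- max_ideal :: 'f set)"
      unfolding open_dist
    proof (intro ballI exI conjI allI impI)
      fix x z :: 'f
      assume "x \<in> - max_ideal" "dist z x < 1"
      then show "z \<in> - max_ideal"
        using dist_ultrametric[of x 0 z] by (auto simp: max_ideal_def dist_commute)
    qed simp
    then show ?thesis
      by (simp add: closed_def)
  qed
  moreover have "max_ideal \<subseteq> (*) (inverse y) ` {x. dist x 0 \<le> e}"
  proof
    fix x :: 'f
    assume "x \<in> max_ideal"
    then have "dist (y * x) 0 \<le> e"
      using y e(1) mult_mono[of "dist y 0" e "dist x 0" 1]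
      by (auto simp: dist_mult_zero max_ideal_def)
    moreover have "x = inverse y * (y * x)"
      using y by simp
    ultimately show "x \<in> (*) (inverse y) ` {x. dist x 0 \<le> e}"
      by blast
  qed
  ultimately show ?thesis
    using compact_Int_closed by (metis inf.absorb_iff2)
qed

text \<open>Discreteness of the valuation is not among the axioms. It is extracted from compactness:
  the absolute value attains a maximum on the maximal ideal, and an element where this happens
  generates the ideal.\<close>

definition uniformizer :: "'f::nonarch_local_field" where
  "uniformizer = (SOME p::'f. p \<noteq> 0 \<and> dist p 0 < 1 \<and> (\<forall>x\<in>max_ideal. dist (x::'f) 0 \<le> dist p 0))"

lemma uniformizer:
  shows uniformizer_nonzero [simp]: "(uniformizer :: 'f::nonarch_local_field) \<noteq> 0"
    and abs_uniformizer_less: "dist (uniformizer :: 'f) 0 < 1"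
    and abs_le_uniformizer: "dist (x::'f) 0 < 1 \<Longrightarrow> dist x 0 \<le> dist (uniformizer :: 'f) 0"
proof -
  obtain t :: 'f where t: "t \<noteq> 0" "dist t 0 < 1"
    using max_ideal_nontrivial by blast
  have "continuous_on (max_ideal :: 'f set) (\<lambda>x. dist x 0)"
    by (intro continuous_intros)
  moreover have "(max_ideal :: 'f set) \<noteq> {}"
    using t by (auto simp: max_ideal_def)
  ultimately have "\<exists>p\<in>max_ideal. \<forall>x\<in>max_ideal. dist x (0::'f) \<le> dist p (0::'f)"
    by (rule continuous_attains_sup[OF compact_max_ideal, rotated])
  then obtain p :: 'f where p: "p \<in> max_ideal" "\<forall>x\<in>max_ideal. dist x (0::'f) \<le> dist p 0"
    by blast
  then have "p \<noteq> 0"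
    using t by (force simp: max_ideal_def)
  with p have "\<exists>p::'f. p \<noteq> 0 \<and> dist p 0 < 1 \<and> (\<forall>x\<in>max_ideal. dist x (0::'f) \<le> dist p 0)"
    by (auto simp: max_ideal_def)
  from someI_ex[OF this] show "(uniformizer :: 'f) \<noteq> 0" "dist (uniformizer :: 'f) 0 < 1"
    "dist (x::'f) 0 < 1 \<Longrightarrow> dist x 0 \<le> dist (uniformizer :: 'f) 0"
    by (auto simp: uniformizer_def max_ideal_def)
qed

lemma uniformizer_int [simp]: "uniformizer \<in> int_ring"
  using abs_uniformizer_less by (auto simp: int_ring_iff intro: less_imp_le)

lemma max_ideal_iff: "x \<in> max_ideal \<longleftrightarrow> dist x 0 \<le> dist (uniformizer::'f) 0"
  for x :: "'f::nonarch_local_field"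
  using abs_uniformizer_less[where ?'f = 'f] abs_le_uniformizer[of x]
  by (auto simp: max_ideal_def simp del: dist_eq_0_iff)

lemma max_ideal_eq: "x \<in> max_ideal \<longleftrightarrow> (\<exists>y\<in>int_ring. x = uniformizer * y)"
proof
  assume "x \<in> max_ideal"
  then have "x / uniformizer \<in> int_ring" "x = uniformizer * (x / uniformizer)"
    by (auto simp: int_ring_iff max_ideal_iff abs_divide)
  then show "\<exists>y\<in>int_ring. x = uniformizer * y"
    by blast
next
  assume "\<exists>y\<in>int_ring. x = uniformizer * y"
  then show "x \<in> max_ideal"
    by (auto simp: max_ideal_iff int_ring_iff dist_mult_zero mult_left_le)
qed

lemma not_max_ideal_imp_unit: "x \<in> int_ring \<Longrightarrow> x \<notin> max_ideal \<Longrightarrow> dist x 0 = 1"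
  by (auto simp: int_ring_iff max_ideal_def)

text \<open>By the ultrametric inequality a finite sum of products is no larger than the common
  bound on its terms; conversely the single product of \<open>uniformizer\<close> and
  \<open>x / uniformizer\<close> represents x. Ideal membership thus becomes a bound on one absolute
  value.\<close>

lemma max_ideal_pow_iff:
  "x \<in> max_ideal_pow n \<longleftrightarrow> dist x 0 \<le> dist (uniformizer::'f) 0 ^ n"
  for x :: "'f::nonarch_local_field"
proof (induction n arbitrary: x)
  case 0
  then show ?case by (simp add: int_ring_iff)
next
  case (Suc n)
  let ?w = "uniformizer :: 'f"
  show ?case
  proof
    assume "x \<in> max_ideal_pow (Suc n)"
    then obtain m :: nat and a b where x: "x = (\<Sum>i<m. a i * b i)"
      and ab: "\<forall>i<m. a i \<in> max_ideal \<and> b i \<in> max_ideal_pow n"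
      by auto
    have *: "dist (a i * b i) 0 \<le> dist ?w 0 ^ Suc n" if "i < m" for i
    proof -
      have "dist (a i) 0 \<le> dist ?w 0" "dist (b i) 0 \<le> dist ?w 0 ^ n"
        using ab that by (auto simp: Suc.IH max_ideal_iff)
      then show ?thesis
        by (simp add: dist_mult_zero mult_mono)
    qed
    have "dist (\<Sum>i<l. a i * b i) 0 \<le> dist ?w 0 ^ Suc n" if "l \<le> m" for l
      using that
    proof (induction l)
      case (Suc l)
      then show ?case
        using *[of l] abs_add[of "\<Sum>i<l. a i * b i" "a l * b l"] by simp
    qed simp
    then show "dist x 0 \<le> dist ?w 0 ^ Suc n"
      using x by blast
  next
    assume *: "dist x 0 \<le> dist ?w 0 ^ Suc n"
    then have "x / ?w \<in> max_ideal_pow n"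
      by (simp add: Suc.IH abs_divide pos_divide_le_eq mult.commute)
    moreover have "?w \<in> max_ideal"
      by (simp add: max_ideal_iff)
    moreover have "x = (\<Sum>i<(1::nat). ?w * (x / ?w))"
      by simp
    ultimately show "x \<in> max_ideal_pow (Suc n)"
      unfolding max_ideal_pow.simps
      by (intro CollectI exI[of _ "1::nat"] exI[of _ "\<lambda>_. ?w"] exI[of _ "\<lambda>_. x / ?w"]) auto
  qed
qed

section \<open>Matrices and the group \<open>PGL(2,F)\<close>\<close>

definition mat2 :: "'a \<Rightarrow> 'a \<Rightarrow> 'a \<Rightarrow> 'a \<Rightarrow> 'a ^ 2 ^ 2" where
  "mat2 a b c d = (\<chi> i j. if i = 1 then (if j = 1 then a else b) else (if j = 1 then c else d))"

lemma mat2_nth [simp]: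
  "mat2 a b c d $ 1 $ 1 = a" "mat2 a b c d $ 1 $ 2 = b"
  "mat2 a b c d $ 2 $ 1 = c" "mat2 a b c d $ 2 $ 2 = d"
  by (simp_all add: mat2_def)

lemma mat2_eqI:
  "A $ 1 $ 1 = B $ 1 $ 1 \<Longrightarrow> A $ 1 $ 2 = B $ 1 $ 2 \<Longrightarrow> A $ 2 $ 1 = B $ 2 $ 1 \<Longrightarrow>
    A $ 2 $ 2 = B $ 2 $ 2 \<Longrightarrow> A = (B :: 'a ^ 2 ^ 2)"
  by (simp add: vec_eq_iff forall_2)

lemma mult_2_nth: "(A ** B) $ i $ j = A $ i $ 1 * B $ 1 $ j + A $ i $ 2 * B $ 2 $ j"
  for A B :: "'a::semiring_1 ^ 2 ^ 2"
  by (simp add: matrix_matrix_mult_def sum_2)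

lemma mult_vec_2_nth: "(A *v x) $ i = A $ i $ 1 * x $ 1 + A $ i $ 2 * x $ 2"
  for A :: "'a::semiring_1 ^ 2 ^ 2"
  by (simp add: matrix_vector_mult_def sum_2)

lemma mat_nth [simp]: "mat c $ i $ j = (if i = j then c else 0)"
  by (simp add: mat_def)

lemma vec2_eqI: "x $ 1 = y $ 1 \<Longrightarrow> x $ 2 = y $ 2 \<Longrightarrow> x = (y :: 'a ^ 2)"
  by (simp add: vec_eq_iff forall_2)

lemma mat_mult_commute: "mat c ** A = A ** mat c" for A :: "'a::field ^ 2 ^ 2"
  by (rule mat2_eqI) (simp_all add: mult_2_nth)

lemma mat_mult_mat: "mat c ** mat d = (mat (c * d) :: 'a::field ^ 2 ^ 2)"
  by (rule mat2_eqI) (simp_all add: mult_2_nth)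

lemma mat_mult_mat_left: "mat c ** (mat d ** A) = mat (c * d) ** A" for A :: "'a::field ^ 2 ^ 2"
  by (simp add: matrix_mul_assoc mat_mult_mat)

lemma mat_mult_vec: "mat c *v x = c *s x" for x :: "'a::field ^ 2"
  by (rule vec2_eqI) (simp_all add: mult_vec_2_nth)

lemma invertible_mat: "c \<noteq> 0 \<Longrightarrow> invertible (mat c :: 'a::field ^ 2 ^ 2)"
  by (simp add: invertible_det_nz det_2)

lemma invertible_one: "invertible (mat 1 :: 'a::field ^ 2 ^ 2)"
  by (simp add: invertible_mat)

lemma inverse_matrix:
  fixes A :: "'a::field ^ 2 ^ 2"
  assumes "invertible A"
  obtains B where "invertible B" "A ** B = mat 1" "B ** A = mat 1"
  using assms unfolding invertible_def by blast

lemma GL2_simps [simp]: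
  "carrier GL2 = {A. invertible A}" "A \<otimes>\<^bsub>GL2\<^esub> B = A ** B" "\<one>\<^bsub>GL2\<^esub> = mat 1"
  by (simp_all add: GL2_def)

lemma group_GL2: "group (GL2 :: ('a::field ^ 2 ^ 2) monoid)"
proof (rule groupI)
  fix A :: "'a ^ 2 ^ 2"
  assume "A \<in> carrier GL2"
  then show "\<exists>B\<in>carrier GL2. B \<otimes>\<^bsub>GL2\<^esub> A = \<one>\<^bsub>GL2\<^esub>"
    by (auto elim: inverse_matrix)
qed (auto simp: invertible_mult matrix_mul_assoc invertible_one)

lemma normal_scalars: "scalars \<lhd> (GL2 :: ('a::field ^ 2 ^ 2) monoid)"
proof -
  interpret group "GL2 :: ('a ^ 2 ^ 2) monoid"
    by (rule group_GL2)
  have inv: "inv\<^bsub>GL2\<^esub> mat c = (mat (inverse c) :: 'a ^ 2 ^ 2)" if "c \<noteq> 0" for c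
    using that by (intro inv_equality) (auto simp: mat_mult_mat invertible_mat)
  have "subgroup scalars (GL2 :: ('a ^ 2 ^ 2) monoid)"
  proof (rule subgroupI)
    show "scalars \<noteq> ({} :: ('a ^ 2 ^ 2) set)"
      by (auto simp: scalars_def intro!: exI[of _ 1])
  next
    fix A :: "'a ^ 2 ^ 2"
    assume "A \<in> scalars"
    then show "inv\<^bsub>GL2\<^esub> A \<in> scalars"
      by (auto simp: scalars_def inv)
  next
    fix A B :: "'a ^ 2 ^ 2"
    assume "A \<in> scalars" "B \<in> scalars"
    then show "A \<otimes>\<^bsub>GL2\<^esub> B \<in> scalars"
      by (auto simp: scalars_def mat_mult_mat)
  qed (auto simp: scalars_def invertible_mat)
  then show ?thesis
    by (rule normalI) (auto simp: r_coset_def l_coset_def scalars_def mat_mult_commute)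
qed

lemma to_PGL2_eq: "to_PGL2 A = {mat c ** A | c. c \<noteq> 0}"
  by (auto simp: to_PGL2_def r_coset_def scalars_def)

lemma carrier_PGL2: "carrier PGL2 = to_PGL2 ` {A. invertible A}"
  by (auto simp: PGL2_def FactGroup_def RCOSETS_def to_PGL2_def)

lemma to_PGL2_carrier [intro]: "invertible A \<Longrightarrow> to_PGL2 A \<in> carrier PGL2"
  by (auto simp: carrier_PGL2)

lemma group_PGL2: "group (PGL2 :: ('a::field ^ 2 ^ 2) set monoid)"
  unfolding PGL2_def by (intro normal.factorgroup_is_group normal_scalars)

lemma to_PGL2_mult:
  "invertible A \<Longrightarrow> invertible B \<Longrightarrow> to_PGL2 A \<otimes>\<^bsub>PGL2\<^esub> to_PGL2 B = to_PGL2 (A ** B)"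
  using normal.rcos_sum[OF normal_scalars, of A B]
  by (simp add: PGL2_def FactGroup_def to_PGL2_def)

lemma to_PGL2_one: "to_PGL2 (mat 1) = \<one>\<^bsub>PGL2\<^esub>"
proof -
  have "to_PGL2 (mat 1) = (scalars :: ('a::field ^ 2 ^ 2) set)"
    by (auto simp: to_PGL2_eq scalars_def)
  then show ?thesis
    by (simp add: PGL2_def FactGroup_def)
qed


section \<open>Vertices of the tree\<close>

definition int_lattice :: "('f::nonarch_local_field ^ 2) set" where
  "int_lattice = {x. x $ 1 \<in> int_ring \<and> x $ 2 \<in> int_ring}"

text \<open>For invertible \<open>A\<close> this is the class of the lattice spanned by the columns
  of \<open>A\<close>, so that the action of the group on vertices becomes left multiplication of
  matrices.\<close>

definition vertex_of :: "'f::nonarch_local_field ^ 2 ^ 2 \<Rightarrow> ('f ^ 2) set set" where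
  "vertex_of A = homothety_class ((*v) A ` int_lattice)"

lemma vertex_of_eq: "vertex_of A = {(*v) (mat c ** A) ` int_lattice | c. c \<noteq> 0}"
  by (simp add: vertex_of_def homothety_class_def image_image matrix_vector_mul_assoc
      flip: mat_mult_vec)

lemma independent_columns_iff:
  fixes u v :: "'a::field ^ 2"
  shows "u \<noteq> v \<and> vec.independent {u, v} \<longleftrightarrow> u $ 1 * v $ 2 \<noteq> u $ 2 * v $ 1"
proof -
  have "u \<noteq> v \<and> vec.independent {u, v} \<longleftrightarrow> v \<noteq> 0 \<and> (\<forall>k. u \<noteq> k *s v)"
    by (auto simp: vec.independent_insert vec.span_singleton)
      (metis vec.scale_one)+
  also have "\<dots> \<longleftrightarrow> u $ 1 * v $ 2 \<noteq> u $ 2 * v $ 1"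
  proof
    assume *: "v \<noteq> 0 \<and> (\<forall>k. u \<noteq> k *s v)"
    show "u $ 1 * v $ 2 \<noteq> u $ 2 * v $ 1"
    proof
      assume eq: "u $ 1 * v $ 2 = u $ 2 * v $ 1"
      from * consider "v $ 1 \<noteq> 0" | "v $ 2 \<noteq> 0"
        by (metis vec2_eqI zero_index)
      then show False
      proof cases
        case 1
        then have "u = (u $ 1 / v $ 1) *s v"
          using eq by (intro vec2_eqI) (simp_all add: field_simps)
        with * show False by blast
      next
        case 2
        then have "u = (u $ 2 / v $ 2) *s v"
          using eq by (intro vec2_eqI) (simp_all add: field_simps)
        with * show False by blast
      qed
    qed
  next
    assume "u $ 1 * v $ 2 \<noteq> u $ 2 * v $ 1"
    then show "v \<noteq> 0 \<and> (\<forall>k. u \<noteq> k *s v)"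
      by auto
  qed
  finally show ?thesis .
qed

lemma is_lattice_iff:
  fixes L :: "('f::nonarch_local_field ^ 2) set"
  \<comment> \<open>A basis of the lattice is read as the pair of columns of a matrix; linear
    independence is then the nonvanishing of the determinant.\<close>
  shows "is_lattice L \<longleftrightarrow> (\<exists>A. invertible A \<and> L = (*v) A ` int_lattice)"
proof -
  have span: "{a *s u + b *s v | a b. a \<in> int_ring \<and> b \<in> int_ring} =
      (*v) (mat2 (u $ 1) (v $ 1) (u $ 2) (v $ 2)) ` int_lattice" for u v :: "'f ^ 2"
  proof -
    have "a *s u + b *s v = mat2 (u $ 1) (v $ 1) (u $ 2) (v $ 2) *v vector [a, b]" for a b
      by (rule vec2_eqI) (simp_all add: mult_vec_2_nth vector_2 mult.commute)
    moreover have "x = vector [x $ 1, x $ 2]" for x :: "'f ^ 2"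
      by (rule vec2_eqI) (simp_all add: vector_2)
    ultimately show ?thesis
      unfolding int_lattice_def by (auto simp: image_iff vector_2) (metis vector_2)+
  qed
  show ?thesis
  proof
    assume "is_lattice L"
    then obtain u v :: "'f ^ 2" where "u $ 1 * v $ 2 \<noteq> u $ 2 * v $ 1"
      "L = (*v) (mat2 (u $ 1) (v $ 1) (u $ 2) (v $ 2)) ` int_lattice"
      unfolding is_lattice_def span by (metis independent_columns_iff)
    then show "\<exists>A. invertible A \<and> L = (*v) A ` int_lattice"
      by (intro exI[of _ "mat2 (u $ 1) (v $ 1) (u $ 2) (v $ 2)"])
        (simp add: invertible_det_nz det_2 mult.commute)
  next
    assume "\<exists>A. invertible A \<and> L = (*v) A ` int_lattice"
    then obtain A where A: "invertible A" "L = (*v) A ` int_lattice"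
      by blast
    let ?u = "column 1 A" and ?v = "column 2 A"
    have "mat2 (?u $ 1) (?v $ 1) (?u $ 2) (?v $ 2) = A"
      by (rule mat2_eqI) (simp_all add: column_def)
    moreover have "?u $ 1 * ?v $ 2 \<noteq> ?u $ 2 * ?v $ 1"
      using A(1) by (simp add: invertible_det_nz det_2 column_def mult.commute)
    ultimately show "is_lattice L"
      unfolding is_lattice_def span using A(2) by (metis independent_columns_iff)
  qed
qed

lemma tree_vertices_eq: "tree_vertices = vertex_of ` {A. invertible A}"
  by (auto simp: tree_vertices_def is_lattice_iff vertex_of_def)

lemma vertex_of_scale:
  assumes "c \<noteq> 0"
  shows "vertex_of (mat c ** A) = vertex_of A"
proof -
  have "(\<exists>d. X = (*v) (mat (d * c) ** A) ` int_lattice \<and> d \<noteq> 0) \<longleftrightarrow>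
      (\<exists>d. X = (*v) (mat d ** A) ` int_lattice \<and> d \<noteq> 0)" for X
    using assms by (metis mult_eq_0_iff divide_eq_0_iff nonzero_eq_divide_eq)
  then show ?thesis
    by (auto simp: vertex_of_eq mat_mult_mat_left)
qed

lemma GL2_int_image:
  fixes U :: "'f::nonarch_local_field ^ 2 ^ 2"
  assumes "U \<in> GL2_int"
  shows "(*v) U ` int_lattice = int_lattice"
proof
  have int: "U $ i $ j \<in> int_ring" for i j
    using assms by (auto simp: GL2_int_def)
  then show "(*v) U ` int_lattice \<subseteq> int_lattice"
    by (auto simp: int_lattice_def mult_vec_2_nth intro!: int_ring_add int_ring_mult)
  show "int_lattice \<subseteq> (*v) U ` int_lattice"
  proof
    fix y :: "'f ^ 2"
    assume y: "y \<in> int_lattice"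
    define e where "e = inverse (det U)"
    have det: "dist (det U) 0 = 1"
      using assms by (simp add: GL2_int_def int_units_iff)
    then have "e * det U = 1"
      unfolding e_def by (intro left_inverse) auto
    then have e: "e * (U $ 1 $ 1 * U $ 2 $ 2 - U $ 1 $ 2 * U $ 2 $ 1) = 1"
      by (simp add: det_2)
    have e_int: "e \<in> int_ring"
      by (simp add: e_def int_ring_iff abs_inverse det)
    \<comment> \<open>Cramer's rule. The solution is integral because the determinant is a
      unit.\<close>
    define x :: "'f ^ 2" where "x = vector [e * (U $ 2 $ 2 * y $ 1 - U $ 1 $ 2 * y $ 2),
      e * (U $ 1 $ 1 * y $ 2 - U $ 2 $ 1 * y $ 1)]"
    have "x \<in> int_lattice"
      using y by (simp add: int_lattice_def x_def vector_2 int_ring_mult int_ring_diff int e_int)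
    moreover have "y = U *v x"
    proof (rule vec2_eqI)
      have "(U *v x) $ 1 = e * (U $ 1 $ 1 * U $ 2 $ 2 - U $ 1 $ 2 * U $ 2 $ 1) * y $ 1"
        by (simp add: mult_vec_2_nth x_def vector_2 algebra_simps)
      then show "y $ 1 = (U *v x) $ 1"
        by (simp add: e)
      have "(U *v x) $ 2 = e * (U $ 1 $ 1 * U $ 2 $ 2 - U $ 1 $ 2 * U $ 2 $ 1) * y $ 2"
        by (simp add: mult_vec_2_nth x_def vector_2 algebra_simps)
      then show "y $ 2 = (U *v x) $ 2"
        by (simp add: e)
    qed
    ultimately show "y \<in> (*v) U ` int_lattice"
      by blast
  qed
qed

lemma vertex_of_mult_int:
  assumes "U \<in> GL2_int"
  shows "vertex_of (A ** U) = vertex_of A"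
proof -
  have "(*v) (A ** U) ` int_lattice = (*v) A ` (*v) U ` int_lattice"
    by (simp add: image_image matrix_vector_mul_assoc)
  then show ?thesis
    by (simp add: vertex_of_def GL2_int_image[OF assms])
qed

text \<open>The action ranges over all representatives of the group element and of the vertex.
  Scalar matrices are central, so the choices only contribute a common homothety factor.\<close>

lemma act_vertex_of:
  "act_vertex (to_PGL2 B) (vertex_of A) = vertex_of (B ** A)"
proof -
  have *: "(*v) (mat c ** B) ` (*v) (mat d ** A) ` int_lattice =
      (*v) (mat (c * d) ** (B ** A)) ` int_lattice" for c d
  proof -
    have "mat c ** B ** (mat d ** A) = mat c ** (B ** mat d) ** A"
      by (simp add: matrix_mul_assoc)
    also have "B ** mat d = mat d ** B"
      by (rule mat_mult_commute[symmetric])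
    also have "mat c ** (mat d ** B) ** A = mat (c * d) ** (B ** A)"
      by (simp add: matrix_mul_assoc mat_mult_mat)
    finally show ?thesis
      by (simp add: image_image matrix_vector_mul_assoc)
  qed
  have "act_vertex (to_PGL2 B) (vertex_of A) =
      {(*v) (mat c ** B) ` (*v) (mat d ** A) ` int_lattice | c d. c \<noteq> 0 \<and> d \<noteq> 0}"
    unfolding act_vertex_def to_PGL2_eq vertex_of_eq by auto
  also have "\<dots> = {(*v) (mat (c * d) ** (B ** A)) ` int_lattice | c d. c \<noteq> 0 \<and> d \<noteq> 0}"
    by (simp only: *)
  also have "\<dots> = vertex_of (B ** A)"
    unfolding vertex_of_eq
  proof (intro Collect_cong iffI)
    fix X
    assume "\<exists>c. X = (*v) (mat c ** (B ** A)) ` int_lattice \<and> c \<noteq> 0"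
    then obtain c where "X = (*v) (mat (c * 1) ** (B ** A)) ` int_lattice" "c \<noteq> 0"
      by auto
    then show "\<exists>c d. X = (*v) (mat (c * d) ** (B ** A)) ` int_lattice \<and> c \<noteq> 0 \<and> d \<noteq> 0"
      by (intro exI[of _ c] exI[of _ 1]) simp
  qed auto
  finally show ?thesis .
qed

section \<open>The action on the tree\<close>

lemma act_vertex_closed:
  assumes "invertible A" "s \<in> tree_vertices"
  shows "act_vertex (to_PGL2 A) s \<in> tree_vertices"
  using assms by (auto simp: tree_vertices_eq act_vertex_of invertible_mult)

lemma act_vertex_cancel:
  assumes "A ** B = mat 1" "B ** A = mat 1" "s \<in> tree_vertices"
  shows "act_vertex (to_PGL2 A) (act_vertex (to_PGL2 B) s) = s"
  using assms by (auto simp: tree_vertices_eq act_vertex_of matrix_mul_assoc)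

lemma to_PGL2_self: "A \<in> to_PGL2 A"
  unfolding to_PGL2_eq by (intro CollectI exI[of _ 1]) simp

text \<open>Linearity carries the multiples of \<open>L\<close> by the maximal ideal to those of its
  image, and injectivity keeps both inclusions strict.\<close>

lemma tree_adj_act:
  assumes "invertible A" "tree_adj s t"
  shows "tree_adj (act_vertex (to_PGL2 A) s) (act_vertex (to_PGL2 A) t)"
proof -
  obtain L M where LM: "L \<in> s" "M \<in> t" "{c *s x | c x. c \<in> max_ideal \<and> x \<in> L} \<subset> M" "M \<subset> L"
    using assms(2) unfolding tree_adj_def by blast
  obtain B where B: "B ** A = mat 1"
    using inverse_matrix[OF assms(1)] by blast
  have inj: "inj ((*v) A)"
    by (rule inj_on_inverseI[where g = "(*v) B"]) (simp add: matrix_vector_mul_assoc B)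
  have "{c *s x | c x. c \<in> max_ideal \<and> x \<in> (*v) A ` L} =
      {c *s (A *v x) | c x. c \<in> max_ideal \<and> x \<in> L}"
    by blast
  also have "\<dots> = {A *v (c *s x) | c x. c \<in> max_ideal \<and> x \<in> L}"
    by (simp add: vector_scalar_commute)
  also have "\<dots> = (*v) A ` {c *s x | c x. c \<in> max_ideal \<and> x \<in> L}"
    by blast
  finally have "{c *s x | c x. c \<in> max_ideal \<and> x \<in> (*v) A ` L} \<subset> (*v) A ` M"
    "(*v) A ` M \<subset> (*v) A ` L"
    using LM(3,4) inj by (simp_all add: psubset_eq inj_image_subset_iff inj_image_eq_iff)
  moreover have "(*v) A ` L \<in> act_vertex (to_PGL2 A) s" "(*v) A ` M \<in> act_vertex (to_PGL2 A) t"
    using LM to_PGL2_self[of A] unfolding act_vertex_def by blast+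
  ultimately show ?thesis
    unfolding tree_adj_def by (intro bexI conjI)
qed

lemma inj_on_act_vertex:
  assumes "invertible A"
  shows "inj_on (act_vertex (to_PGL2 A)) tree_vertices"
proof -
  obtain B where "B ** A = mat 1" "A ** B = mat 1"
    using inverse_matrix[OF assms] by blast
  then show ?thesis
    by (intro inj_on_inverseI[where g = "act_vertex (to_PGL2 B)"]) (simp add: act_vertex_cancel)
qed

lemma act_path_closed:
  assumes "invertible A" "p \<in> paths k"
  shows "act_path (to_PGL2 A) p \<in> paths k"
  using assms inj_on_subset[OF inj_on_act_vertex[OF assms(1)]]
  by (auto simp: paths_def act_path_def distinct_map act_vertex_closed tree_adj_act)

section \<open>Classification of the neighbours of a vertex\<close>

text \<open>Such an \<open>N\<close> corresponds to a line in the plane over the residue field; the two cases are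
  the line spanned by \<open>e\<^sub>2\<close> and the lines spanned by \<open>e\<^sub>1 + x e\<^sub>2\<close>.\<close>

lemma neighbour_lattices:
  fixes N :: "('f::nonarch_local_field ^ 2) set"
  assumes add: "\<And>x y. x \<in> N \<Longrightarrow> y \<in> N \<Longrightarrow> x + y \<in> N"
    and scale: "\<And>a x. a \<in> int_ring \<Longrightarrow> x \<in> N \<Longrightarrow> a *s x \<in> N"
    and sub: "N \<subseteq> int_lattice" and ne: "N \<noteq> int_lattice"
    and low: "\<And>x. x \<in> int_lattice \<Longrightarrow> uniformizer *s x \<in> N"
    and not_low: "m \<in> N" "\<And>x. x \<in> int_lattice \<Longrightarrow> m \<noteq> uniformizer *s x"
  shows "N = (*v) (mat2 uniformizer 0 0 1) ` int_lattice \<or>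
    (\<exists>x\<in>int_ring. N = (*v) (mat2 1 0 x uniformizer) ` int_lattice)"
proof -
  define V :: "'f \<Rightarrow> 'f \<Rightarrow> 'f ^ 2" where "V = (\<lambda>a b. vector [a, b])"
  have V_nth [simp]: "V a b $ 1 = a" "V a b $ 2 = b" for a b
    by (simp_all add: V_def vector_2)
  have V_int [simp]: "V a b \<in> int_lattice \<longleftrightarrow> a \<in> int_ring \<and> b \<in> int_ring" for a b
    by (simp add: int_lattice_def)
  have V_low: "V (uniformizer * a) (uniformizer * b) \<in> N" if "a \<in> int_ring" "b \<in> int_ring" for a b
  proof -
    have "V (uniformizer * a) (uniformizer * b) = uniformizer *s V a b"
      by (rule vec2_eqI) simp_all
    then show ?thesis
      using low[of "V a b"] that by simp
  qed
  have int: "x $ 1 \<in> int_ring" "x $ 2 \<in> int_ring" if "x \<in> N" for x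
    using that sub by (auto simp: int_lattice_def)
  have neg: "a \<in> int_ring \<Longrightarrow> - a \<in> int_ring" for a :: 'f
    by (simp add: int_ring_iff)
  have full: False if "V 1 0 \<in> N" "V 0 1 \<in> N"
  proof -
    have "int_lattice \<subseteq> N"
    proof
      fix x :: "'f ^ 2"
      assume "x \<in> int_lattice"
      then have "x $ 1 *s V 1 0 + x $ 2 *s V 0 1 \<in> N"
        using that by (intro add scale) (auto simp: int_lattice_def)
      moreover have "x $ 1 *s V 1 0 + x $ 2 *s V 0 1 = x"
        by (rule vec2_eqI) simp_all
      ultimately show "x \<in> N"
        by simp
    qed
    then show False
      using sub ne by blast
  qed
  have inverse_int: "inverse a \<in> int_ring" "inverse a * a = 1" if "dist a 0 = 1" for a :: 'f
    using that by (auto simp: int_ring_iff abs_inverse intro: left_inverse)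
  show ?thesis
  proof (cases "\<exists>y\<in>N. y $ 1 \<notin> max_ideal")
    case True
    then obtain y where y: "y \<in> N" "dist (y $ 1) 0 = 1"
      using int(1) not_max_ideal_imp_unit by blast
    \<comment> \<open>The slope of the line: \<open>y\<close> is normalized to have first coordinate
      1, which is possible because that coordinate is a unit.\<close>
    define x where "x = inverse (y $ 1) * y $ 2"
    have x: "x \<in> int_ring"
      using y inverse_int int by (simp add: x_def int_ring_mult)
    have "inverse (y $ 1) *s y = V 1 x"
      by (rule vec2_eqI) (simp_all add: x_def inverse_int y)
    then have e: "V 1 x \<in> N"
      using scale inverse_int y by metis
    have "N = (*v) (mat2 1 0 x uniformizer) ` int_lattice"
    proof
      show "(*v) (mat2 1 0 x uniformizer) ` int_lattice \<subseteq> N"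
      proof
        fix z :: "'f ^ 2"
        assume "z \<in> (*v) (mat2 1 0 x uniformizer) ` int_lattice"
        then obtain w where w: "w \<in> int_lattice" "z = mat2 1 0 x uniformizer *v w"
          by blast
        have "z = w $ 1 *s V 1 x + V (uniformizer * 0) (uniformizer * w $ 2)"
          unfolding w by (rule vec2_eqI) (simp_all add: mult_vec_2_nth mult.commute)
        moreover have "w $ 1 *s V 1 x + V (uniformizer * 0) (uniformizer * w $ 2) \<in> N"
          using w(1) by (intro add scale e V_low) (auto simp: int_lattice_def)
        ultimately show "z \<in> N"
          by simp
      qed
      show "N \<subseteq> (*v) (mat2 1 0 x uniformizer) ` int_lattice"
      proof
        fix z :: "'f ^ 2"
        assume z: "z \<in> N"
        define c where "c = z $ 2 - z $ 1 * x"
        have "z + (- z $ 1) *s V 1 x = V 0 c"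
          by (rule vec2_eqI) (simp_all add: c_def)
        moreover have "z + (- z $ 1) *s V 1 x \<in> N"
          using z e int(1) neg by (intro add scale) auto
        ultimately have c: "V 0 c \<in> N"
          by simp
        \<comment> \<open>A unit \<open>c\<close> would put the second basis vector, and with
          \<open>V 1 x\<close> also the first, into \<open>N\<close>, which is a proper
          sublattice.\<close>
        have "c \<in> max_ideal"
        proof (rule ccontr)
          assume "c \<notin> max_ideal"
          then have unit: "dist c 0 = 1"
            using not_max_ideal_imp_unit int(2)[OF c] by simp
          have "inverse c *s V 0 c = V 0 1"
            by (rule vec2_eqI) (simp_all add: inverse_int unit)
          then have 1: "V 0 1 \<in> N"
            using scale inverse_int unit c by metis
          then have "V 1 x + (- x) *s V 0 1 \<in> N"
            using e x neg by (intro add scale) auto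
          moreover have "V 1 x + (- x) *s V 0 1 = V 1 0"
            by (rule vec2_eqI) simp_all
          ultimately show False
            using full 1 by simp
        qed
        then obtain d where d: "d \<in> int_ring" "c = uniformizer * d"
          by (auto simp: max_ideal_eq)
        have "z = mat2 1 0 x uniformizer *v V (z $ 1) d"
        proof (rule vec2_eqI)
          have "z $ 2 = c + z $ 1 * x"
            by (simp add: c_def)
          then show "z $ 2 = (mat2 1 0 x uniformizer *v V (z $ 1) d) $ 2"
            by (simp add: mult_vec_2_nth d mult.commute)
        qed (simp add: mult_vec_2_nth)
        moreover have "V (z $ 1) d \<in> int_lattice"
          using d int z by simp
        ultimately show "z \<in> (*v) (mat2 1 0 x uniformizer) ` int_lattice"
          by blast
      qed
    qed
    with x show ?thesis
      by blast
  next
    case False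
    then have first: "\<exists>a\<in>int_ring. y $ 1 = uniformizer * a" if "y \<in> N" for y
      using that by (auto simp: max_ideal_eq)
    \<comment> \<open>All first coordinates are divisible by \<open>uniformizer\<close> in this
      case, so a divisible second coordinate would make \<open>m\<close> a multiple of
      \<open>uniformizer\<close> in the standard lattice.\<close>
    have "m $ 2 \<notin> max_ideal"
    proof
      assume "m $ 2 \<in> max_ideal"
      then obtain b where b: "b \<in> int_ring" "m $ 2 = uniformizer * b"
        by (auto simp: max_ideal_eq)
      obtain a where a: "a \<in> int_ring" "m $ 1 = uniformizer * a"
        using first not_low(1) by blast
      have "m = uniformizer *s V a b"
        by (rule vec2_eqI) (simp_all add: a b)
      then show False
        using not_low(2)[of "V a b"] a b by simp
    qed
    then have unit: "dist (m $ 2) 0 = 1"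
      using int(2) not_low(1) not_max_ideal_imp_unit by blast
    obtain a where a: "a \<in> int_ring" "m $ 1 = uniformizer * a"
      using first not_low(1) by blast
    have "inverse (m $ 2) *s (m + V (uniformizer * - a) (uniformizer * 0)) = V 0 1"
      by (rule vec2_eqI) (simp_all add: a inverse_int unit)
    moreover have "inverse (m $ 2) *s (m + V (uniformizer * - a) (uniformizer * 0)) \<in> N"
      using a neg not_low(1) inverse_int unit by (intro add scale V_low) auto
    ultimately have e: "V 0 1 \<in> N"
      by simp
    have "N = (*v) (mat2 uniformizer 0 0 1) ` int_lattice"
    proof
      show "(*v) (mat2 uniformizer 0 0 1) ` int_lattice \<subseteq> N"
      proof
        fix z :: "'f ^ 2"
        assume "z \<in> (*v) (mat2 uniformizer 0 0 1) ` int_lattice"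
        then obtain w where w: "w \<in> int_lattice" "z = mat2 uniformizer 0 0 1 *v w"
          by blast
        have "z = w $ 2 *s V 0 1 + V (uniformizer * w $ 1) (uniformizer * 0)"
          unfolding w by (rule vec2_eqI) (simp_all add: mult_vec_2_nth)
        moreover have "w $ 2 *s V 0 1 + V (uniformizer * w $ 1) (uniformizer * 0) \<in> N"
          using w(1) by (intro add scale e V_low) (auto simp: int_lattice_def)
        ultimately show "z \<in> N"
          by simp
      qed
      show "N \<subseteq> (*v) (mat2 uniformizer 0 0 1) ` int_lattice"
      proof
        fix z :: "'f ^ 2"
        assume z: "z \<in> N"
        obtain d where d: "d \<in> int_ring" "z $ 1 = uniformizer * d"
          using first z by blast
        have "z = mat2 uniformizer 0 0 1 *v V d (z $ 2)"
          by (rule vec2_eqI) (simp_all add: mult_vec_2_nth d)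
        moreover have "V d (z $ 2) \<in> int_lattice"
          using d int z by simp
        ultimately show "z \<in> (*v) (mat2 uniformizer 0 0 1) ` int_lattice"
          by blast
      qed
    qed
    then show ?thesis
      by blast
  qed
qed

lemma neighbours_of_origin:
  assumes adj: "tree_adj (vertex_of (mat 1)) t" and t: "t \<in> tree_vertices"
  shows "t = vertex_of (mat2 uniformizer 0 0 1) \<or>
    (\<exists>x\<in>int_ring. t = vertex_of (mat2 1 0 x (uniformizer :: 'f::nonarch_local_field)))"
proof -
  obtain A :: "'f ^ 2 ^ 2" where A: "t = vertex_of A"
    using t by (auto simp: tree_vertices_eq)
  obtain L M where LM: "L \<in> vertex_of (mat 1)" "M \<in> t"
    "{c *s x | c x. c \<in> max_ideal \<and> x \<in> L} \<subset> M" "M \<subset> L"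
    using adj unfolding tree_adj_def by blast
  obtain c where c: "c \<noteq> 0" "L = (*v) (mat c) ` int_lattice"
    using LM(1) by (auto simp: vertex_of_eq)
  obtain d where d: "d \<noteq> 0" "M = (*v) (mat d ** A) ` int_lattice"
    using LM(2) by (auto simp: A vertex_of_eq)
  \<comment> \<open>Adjacency is witnessed by lattices \<open>L\<close> and \<open>M\<close> of
    arbitrary scale. Dividing both by \<open>c\<close> turns \<open>L\<close> into the standard
    lattice and \<open>M\<close> into \<open>N\<close>, without changing the class of
    \<open>M\<close>.\<close>
  define C where "C = mat (inverse c * d) ** A"
  define N where "N = (*v) C ` int_lattice"
  have tN: "t = homothety_class N"
    using c d vertex_of_scale[of "inverse c * d" A] by (simp add: A N_def C_def vertex_of_def)
  have M: "M = (*v) (mat c) ` N"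
    using c d by (simp add: N_def C_def image_image matrix_vector_mul_assoc mat_mult_mat_left
        flip: mult.assoc)
  have inj: "inj ((*v) (mat c :: 'f ^ 2 ^ 2))"
    using c by (intro inj_on_inverseI[where g = "(*v) (mat (inverse c))"])
      (simp add: matrix_vector_mul_assoc mat_mult_mat)
  \<comment> \<open>The set in \<open>tree_adj\<close> consists of products with arbitrary elements
    of the maximal ideal; since the ideal is principal, the factor can be taken to be
    \<open>uniformizer\<close>.\<close>
  have low_eq: "{e *s x | e x. e \<in> max_ideal \<and> x \<in> L} =
      (*v) (mat c :: 'f ^ 2 ^ 2) ` {uniformizer *s x | x. x \<in> int_lattice}"
  proof (intro subset_antisym subsetI)
    fix z :: "'f ^ 2"
    assume "z \<in> {e *s x | e x. e \<in> max_ideal \<and> x \<in> L}"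
    then obtain y x where yx: "y \<in> int_ring" "x \<in> int_lattice"
      and "z = (uniformizer * y) *s (mat c *v x)"
      unfolding c by (auto simp: max_ideal_eq)
    then have "z = mat c *v (uniformizer *s (y *s x))"
      by (simp add: vector_scalar_commute vector_smult_assoc)
    moreover have "y *s x \<in> int_lattice"
      using yx by (simp add: int_lattice_def int_ring_mult)
    ultimately show "z \<in> (*v) (mat c :: 'f ^ 2 ^ 2) ` {uniformizer *s x | x. x \<in> int_lattice}"
      by blast
  next
    fix z :: "'f ^ 2"
    assume "z \<in> (*v) (mat c :: 'f ^ 2 ^ 2) ` {uniformizer *s x | x. x \<in> int_lattice}"
    then obtain x where "x \<in> int_lattice" "z = uniformizer *s (mat c *v x)"
      by (auto simp: vector_scalar_commute)
    moreover have "(uniformizer :: 'f) \<in> max_ideal"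
      by (simp add: max_ideal_iff)
    ultimately show "z \<in> {e *s x | e x. e \<in> max_ideal \<and> x \<in> L}"
      unfolding c by blast
  qed
  have sub: "N \<subset> int_lattice" and low: "{uniformizer *s x | x. x \<in> int_lattice} \<subset> N"
    using LM(3,4) inj unfolding low_eq unfolding M c(2)
    by (simp_all add: psubset_eq inj_image_subset_iff inj_image_eq_iff)
  obtain m where m: "m \<in> N" "m \<notin> {uniformizer *s x | x. x \<in> int_lattice}"
    using low by blast
  have "N = (*v) (mat2 uniformizer 0 0 1) ` int_lattice \<or>
    (\<exists>x\<in>int_ring. N = (*v) (mat2 1 0 x uniformizer) ` int_lattice)"
  proof (rule neighbour_lattices[where m = m])
    show "x + y \<in> N" if xy: "x \<in> N" "y \<in> N" for x y
    proof -
      obtain x' y' where "x = C *v x'" "y = C *v y'" "x' \<in> int_lattice" "y' \<in> int_lattice"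
        using xy unfolding N_def by blast
      then have "x + y = C *v (x' + y')" "x' + y' \<in> int_lattice"
        by (auto simp: int_lattice_def int_ring_add matrix_vector_right_distrib)
      then show ?thesis
        unfolding N_def by blast
    qed
    show "a *s x \<in> N" if a: "a \<in> int_ring" "x \<in> N" for a x
    proof -
      obtain x' where "x = C *v x'" "x' \<in> int_lattice"
        using a(2) unfolding N_def by blast
      then have "a *s x = C *v (a *s x')" "a *s x' \<in> int_lattice"
        using a(1) by (auto simp: int_lattice_def int_ring_mult vector_scalar_commute)
      then show ?thesis
        unfolding N_def by blast
    qed
  qed (use sub low m in auto)
  then show ?thesis
    unfolding tN vertex_of_def by blast
qed

text \<open>By equivariance: the inverse of \<open>A\<close> moves the vertex to the class of the
  standard lattice.\<close>

lemma neighbours: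
  fixes A :: "'f::nonarch_local_field ^ 2 ^ 2"
  assumes A: "invertible A" and adj: "tree_adj (vertex_of A) t" and t: "t \<in> tree_vertices"
  shows "t = vertex_of (A ** mat2 uniformizer 0 0 1) \<or>
    (\<exists>x\<in>int_ring. t = vertex_of (A ** mat2 1 0 x uniformizer))"
proof -
  obtain B where B: "invertible B" "A ** B = mat 1" "B ** A = mat 1"
    using inverse_matrix[OF A] by blast
  let ?t = "act_vertex (to_PGL2 B) t"
  have "tree_adj (vertex_of (mat 1)) ?t"
    using tree_adj_act[OF B(1) adj] by (simp add: act_vertex_of B)
  moreover have "?t \<in> tree_vertices"
    using B(1) t by (rule act_vertex_closed)
  moreover have "t = act_vertex (to_PGL2 A) ?t"
    using B t by (simp add: act_vertex_cancel)
  ultimately show ?thesis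
    using neighbours_of_origin[of ?t] by (metis act_vertex_of)
qed


section \<open>Transitivity on paths\<close>

text \<open>The translate by \<open>g\<close> of the path of the lattices spanned by \<open>e\<^sub>1\<close> and \<open>uniformizer ^ i e\<^sub>2\<close>, \<open>i \<le> k\<close>;
  its orientation is the one for which \<open>Gamma0 k\<close> fixes the path with \<open>g = 1\<close>.\<close>

definition path_of :: "'f::nonarch_local_field ^ 2 ^ 2 \<Rightarrow> nat \<Rightarrow> ('f ^ 2) set set list" where
  "path_of g k = map (\<lambda>i. vertex_of (g ** mat2 1 0 0 (uniformizer ^ i))) [0..<Suc k]"

definition gamma0_mat :: "nat \<Rightarrow> ('f::nonarch_local_field ^ 2 ^ 2) set" where
  "gamma0_mat n = (if n = 0 then GL2_int
     else {A. A $ 1 $ 1 \<in> int_units \<and> A $ 2 $ 2 \<in> int_units \<and>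
       A $ 1 $ 2 \<in> int_ring \<and> A $ 2 $ 1 \<in> max_ideal_pow n})"

lemma Gamma0_eq: "Gamma0 n = to_PGL2 ` gamma0_mat n"
  by (simp add: Gamma0_def gamma0_mat_def)

lemma uniformizer_power_antimono:
  "m \<le> n \<Longrightarrow> dist (uniformizer::'f::nonarch_local_field) 0 ^ n \<le> dist (uniformizer::'f) 0 ^ m"
  using abs_uniformizer_less[where ?'f = 'f] by (intro power_decreasing) auto

lemma gamma0_matD:
  fixes U :: "'f::nonarch_local_field ^ 2 ^ 2"
  assumes "U \<in> gamma0_mat n"
  shows "U \<in> GL2_int" "dist (U $ 2 $ 1) 0 \<le> dist (uniformizer::'f) 0 ^ n"
proof -
  have "U \<in> GL2_int \<and> dist (U $ 2 $ 1) 0 \<le> dist (uniformizer::'f) 0 ^ n"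
  proof (cases "n = 0")
    case True
    then show ?thesis
      using assms by (auto simp: gamma0_mat_def GL2_int_def int_ring_iff)
  next
    case False
    have U: "dist (U $ 1 $ 1) 0 = 1" "dist (U $ 2 $ 2) 0 = 1" "dist (U $ 1 $ 2) 0 \<le> 1"
      "dist (U $ 2 $ 1) 0 \<le> dist (uniformizer::'f) 0 ^ n"
      using assms False by (auto simp: gamma0_mat_def int_units_iff max_ideal_pow_iff int_ring_iff)
    have lt: "dist (U $ 2 $ 1) 0 < 1"
      using U(4) uniformizer_power_antimono[of 1 n, where ?'f = 'f] False
        abs_uniformizer_less[where ?'f = 'f] by simp
    have bc: "dist (U $ 1 $ 2 * U $ 2 $ 1) 0 < 1"
      using U(3) lt mult_left_le_one_le[of "dist (U $ 2 $ 1) 0" "dist (U $ 1 $ 2) 0"]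
      by (simp add: dist_mult_zero)
    have "dist (U $ 1 $ 1 * U $ 2 $ 2) 0 = 1"
      by (simp add: dist_mult_zero U)
    \<comment> \<open>Writing the determinant as ad - bc bounds it by 1; writing ad as the
      determinant plus bc, with |bc| < 1 = |ad|, excludes a smaller value.\<close>
    then have "dist (det U) 0 = 1"
      using bc abs_diff[of "U $ 1 $ 1 * U $ 2 $ 2" "U $ 1 $ 2 * U $ 2 $ 1"]
        abs_add[of "det U" "U $ 1 $ 2 * U $ 2 $ 1"]
      by (simp add: det_2)
    then show ?thesis
      using U lt by (simp add: GL2_int_def forall_2 int_ring_iff int_units_iff)
  qed
  then show "U \<in> GL2_int" "dist (U $ 2 $ 1) 0 \<le> dist (uniformizer::'f) 0 ^ n"
    by simp_all
qed

lemma gamma0_mat_invertible: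
  assumes "U \<in> gamma0_mat n"
  shows "invertible U"
  using gamma0_matD(1)[OF assms] by (auto simp: GL2_int_def int_units_iff invertible_det_nz)

lemma gamma0_mat_Suc: "gamma0_mat (Suc n) \<subseteq> (gamma0_mat n :: ('f::nonarch_local_field ^ 2 ^ 2) set)"
proof
  fix U :: "'f ^ 2 ^ 2"
  assume U: "U \<in> gamma0_mat (Suc n)"
  show "U \<in> gamma0_mat n"
  proof (cases "n = 0")
    case True
    then show ?thesis
      using gamma0_matD(1)[OF U] by (simp add: gamma0_mat_def)
  next
    case False
    then show ?thesis
      using U uniformizer_power_antimono[of n "Suc n", where ?'f = 'f]
      by (simp add: gamma0_mat_def max_ideal_pow_iff del: max_ideal_pow.simps power_Suc)
  qed
qed

lemma Gamma0_antimono: "m \<le> n \<Longrightarrow> Gamma0 n \<subseteq> Gamma0 m"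
  unfolding Gamma0_eq by (intro image_mono) (rule lift_Suc_antimono_le[of gamma0_mat, OF gamma0_mat_Suc])

text \<open>Conjugation by the diagonal matrix of the i-th vertex divides the lower left entry of
  \<open>U\<close> by \<open>uniformizer ^ i\<close>. For i up to k the result \<open>U'\<close> is
  still integral with the same determinant, hence fixes the standard lattice.\<close>

lemma path_of_mult_gamma0:
  fixes g :: "'f::nonarch_local_field ^ 2 ^ 2"
  assumes U: "U \<in> gamma0_mat k"
  shows "path_of (g ** U) k = path_of g k"
proof -
  let ?D = "\<lambda>i. mat2 1 0 0 (uniformizer ^ i) :: 'f ^ 2 ^ 2"
  have "vertex_of (g ** U ** ?D i) = vertex_of (g ** ?D i)" if i: "i \<le> k" for i
  proof -
    define U' where "U' = mat2 (U $ 1 $ 1) (U $ 1 $ 2 * uniformizer ^ i)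
      (U $ 2 $ 1 / uniformizer ^ i) (U $ 2 $ 2)"
    have "dist (U $ 2 $ 1) 0 \<le> dist (uniformizer::'f) 0 ^ i"
      using gamma0_matD(2)[OF U] uniformizer_power_antimono[OF i, where ?'f = 'f] by linarith
    then have "U $ 2 $ 1 / uniformizer ^ i \<in> int_ring"
      by (simp add: int_ring_iff abs_divide abs_power)
    moreover have "det U' = det U"
      by (simp add: det_2 U'_def)
    ultimately have "U' \<in> GL2_int"
      using gamma0_matD(1)[OF U]
      by (simp add: GL2_int_def U'_def forall_2 int_ring_mult int_ring_power)
    moreover have "U ** ?D i = ?D i ** U'"
      by (rule mat2_eqI) (simp_all add: mult_2_nth U'_def)
    ultimately have "g ** U ** ?D i = g ** ?D i ** U'" "U' \<in> GL2_int"
      by (simp_all only: flip: matrix_mul_assoc)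
    then show ?thesis
      by (simp only: vertex_of_mult_int)
  qed
  then show ?thesis
    by (auto simp: path_of_def)
qed

lemma act_path_of: "act_path (to_PGL2 B) (path_of g k) = path_of (B ** g) k"
  by (simp add: act_path_def path_of_def act_vertex_of matrix_mul_assoc)

lemma path_of_Suc:
  "path_of g (Suc k) = path_of g k @ [vertex_of (g ** mat2 1 0 0 (uniformizer ^ Suc k))]"
  by (simp add: path_of_def)

lemma paths_snocD:
  assumes "q @ [t] \<in> paths (Suc k)"
  shows "q \<in> paths k" "t \<in> tree_vertices" "tree_adj (q ! k) t" "t \<notin> set q"
proof -
  have len: "length q = Suc k"
    using assms by (simp add: paths_def)
  have adj: "tree_adj ((q @ [t]) ! i) ((q @ [t]) ! Suc i)" if "i < Suc k" for i
    using assms that by (simp add: paths_def)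
  have "tree_adj (q ! i) (q ! Suc i)" if "i < k" for i
    using adj[of i] that len by (simp add: nth_append)
  then show "q \<in> paths k" "t \<in> tree_vertices" "t \<notin> set q"
    using assms by (simp_all add: paths_def)
  show "tree_adj (q ! k) t"
    using adj[of k] len by (simp add: nth_append)
qed

text \<open>Induction on the length. Once all but the last vertex are in standard position relative
  to \<open>g\<close>, replacing \<open>g\<close> by \<open>g ** U\<close> with \<open>U\<close> in
  \<open>gamma0_mat k\<close> keeps them there, and a suitable \<open>U\<close> accounts for the
  last vertex.\<close>

lemma paths_eq_path_of:
  fixes p :: "('f::nonarch_local_field ^ 2) set set list"
  assumes "p \<in> paths k"
  shows "\<exists>g. invertible g \<and> p = path_of g k"
  using assms
proof (induction k arbitrary: p)
  case 0
  then obtain s where s: "p = [s]" "s \<in> tree_vertices"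
    by (auto simp: paths_def length_Suc_conv)
  then obtain A where A: "invertible A" "s = vertex_of A"
    by (auto simp: tree_vertices_eq)
  have "mat2 1 0 0 1 = (mat 1 :: 'f ^ 2 ^ 2)"
    by (rule mat2_eqI) simp_all
  then show ?case
    using s A by (auto simp: path_of_def)
next
  case (Suc k)
  let ?D = "\<lambda>i. mat2 1 0 0 (uniformizer ^ i) :: 'f ^ 2 ^ 2"
  obtain q t where p: "p = q @ [t]"
    using Suc.prems by (cases p rule: rev_cases) (auto simp: paths_def)
  note q = paths_snocD[OF Suc.prems[unfolded p]]
  obtain g where g: "invertible g" "q = path_of g k"
    using Suc.IH q(1) by blast
  have extend: ?case if U: "U \<in> gamma0_mat k" and t: "t = vertex_of (g ** U ** ?D (Suc k))" for U
    using path_of_mult_gamma0[OF U] gamma0_mat_invertible[OF U] g t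
    by (intro exI[of _ "g ** U"]) (simp add: p path_of_Suc invertible_mult del: power_Suc)
  have qi: "q ! i = vertex_of (g ** ?D i)" if "i \<le> k" for i
    using that by (simp add: g path_of_def nth_append del: upt_Suc)
  have "invertible (g ** ?D k)"
    using g by (intro invertible_mult) (simp_all add: invertible_det_nz det_2)
  then consider "t = vertex_of (g ** ?D k ** mat2 uniformizer 0 0 1)"
    | x where "x \<in> int_ring" "t = vertex_of (g ** ?D k ** mat2 1 0 x uniformizer)"
    using neighbours[of "g ** ?D k" t] q(2,3) qi by auto
  then show ?case
  proof cases
    case 1
    show ?thesis
    proof (cases k)
      case 0
      \<comment> \<open>A single vertex has no predecessor, so this neighbour is a genuine
        extension. Exchanging the basis vectors, an element of \<open>gamma0_mat 0\<close>, makes it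
        standard.\<close>
      let ?W = "mat2 0 1 1 0 :: 'f ^ 2 ^ 2"
      have "?W \<in> GL2_int"
        by (simp add: GL2_int_def forall_2 det_2 int_units_iff)
      have swap: "?D k ** mat2 uniformizer 0 0 1 = ?W ** (?D (Suc k) ** ?W)"
        by (rule mat2_eqI) (simp_all add: mult_2_nth 0)
      have "t = vertex_of (g ** ?W ** ?D (Suc k) ** ?W)"
        unfolding 1 by (simp only: swap flip: matrix_mul_assoc)
      then have "t = vertex_of (g ** ?W ** ?D (Suc k))"
        using \<open>?W \<in> GL2_int\<close> by (simp only: vertex_of_mult_int)
      then show ?thesis
        using \<open>?W \<in> GL2_int\<close> by (intro extend) (simp_all add: gamma0_mat_def 0)
    next
      case (Suc j)
      \<comment> \<open>This neighbour is homothetic to the vertex before the last one: the path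
        would turn back, against the injectivity of paths.\<close>
      have "?D k ** mat2 uniformizer 0 0 1 = mat uniformizer ** ?D j"
        by (rule mat2_eqI) (simp_all add: mult_2_nth Suc mult.commute)
      then have "g ** ?D k ** mat2 uniformizer 0 0 1 = g ** mat uniformizer ** ?D j"
        by (simp only: flip: matrix_mul_assoc)
      also have "\<dots> = mat uniformizer ** (g ** ?D j)"
        by (simp only: matrix_mul_assoc mat_mult_commute[of uniformizer g])
      finally have "g ** ?D k ** mat2 uniformizer 0 0 1 = mat uniformizer ** (g ** ?D j)" .
      then have "t = q ! j"
        using 1 qi[of j] Suc by (simp add: vertex_of_scale)
      moreover have "j < length q"
        using Suc by (simp add: g path_of_def)
      ultimately show ?thesis
        using q(4) by simp
    qed
  next
    case 2
    \<comment> \<open>Moving the slope x to the left past the diagonal matrix multiplies it by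
      \<open>uniformizer ^ k\<close>, which is precisely the divisibility required by
      \<open>gamma0_mat k\<close>.\<close>
    let ?U = "mat2 1 0 (x * uniformizer ^ k) 1 :: 'f ^ 2 ^ 2"
    have "dist (x * uniformizer ^ k) 0 \<le> dist (uniformizer::'f) 0 ^ k"
      using 2(1) by (simp add: int_ring_iff dist_mult_zero abs_power mult_left_le_one_le)
    then have "?U \<in> gamma0_mat k"
      using 2(1) by (simp add: gamma0_mat_def GL2_int_def forall_2 det_2 int_units_iff
          max_ideal_pow_iff int_ring_mult int_ring_power)
    moreover have "?D k ** mat2 1 0 x uniformizer = ?U ** ?D (Suc k)"
      by (rule mat2_eqI) (simp_all add: mult_2_nth mult.commute)
    then have "t = vertex_of (g ** ?U ** ?D (Suc k))"
      unfolding 2(2) by (simp only: flip: matrix_mul_assoc)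
    ultimately show ?thesis
      by (rule extend)
  qed
qed

section \<open>The group action on paths and edges\<close>

lemma paths_act_eq:
  assumes "p \<in> paths k" "q \<in> paths k"
  shows "\<exists>A. invertible A \<and> q = act_path (to_PGL2 A) p"
proof -
  obtain g h where gh: "invertible g" "p = path_of g k" "invertible h" "q = path_of h k"
    using assms paths_eq_path_of by metis
  obtain g' where g': "invertible g'" "g' ** g = mat 1"
    using inverse_matrix[OF gh(1)] by blast
  have "q = act_path (to_PGL2 (h ** g')) p"
    by (simp add: gh act_path_of g' flip: matrix_mul_assoc)
  then show ?thesis
    using gh g' invertible_mult by blast
qed

lemma act_path_mult:
  assumes "p \<in> paths k" "invertible A" "invertible B"
  shows "act_path (to_PGL2 (A ** B)) p = act_path (to_PGL2 A) (act_path (to_PGL2 B) p)"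
  using paths_eq_path_of[OF assms(1)] by (auto simp: act_path_of matrix_mul_assoc)

lemma act_path_one: "p \<in> paths k \<Longrightarrow> act_path (to_PGL2 (mat 1)) p = p"
  using paths_eq_path_of[of p k] by (auto simp: act_path_of)

lemma inj_on_act_path:
  assumes "invertible A"
  shows "inj_on (act_path (to_PGL2 A)) (paths k)"
proof -
  obtain B where B: "invertible B" "B ** A = mat 1"
    using inverse_matrix[OF assms] by blast
  show ?thesis
    by (rule inj_on_inverseI[where g = "act_path (to_PGL2 B)"])
      (metis B act_path_mult act_path_one assms)
qed

lemma edge_head_act: "edge_head (act_path g a) = act_path g (edge_head a)"
  and edge_tail_act: "edge_tail (act_path g a) = act_path g (edge_tail a)"
  by (simp_all add: edge_head_def edge_tail_def act_path_def map_tl map_butlast)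

text \<open>Keeps the two nonzero cases of \<open>incidence\<close> apart, so that the sum in
  \<open>dstar\<close> splits over disjoint sets of edges.\<close>

lemma edge_head_neq_tail:
  assumes "a \<in> graph_edges k"
  shows "edge_head a \<noteq> edge_tail a"
proof -
  have a: "length a = Suc (Suc k)" "distinct a"
    using assms by (simp_all add: graph_edges_def paths_def)
  have "edge_head a ! 0 = a ! 1" "edge_tail a ! 0 = a ! 0"
    using a by (simp_all add: edge_head_def edge_tail_def nth_tl nth_butlast)
  moreover have "a ! 1 \<noteq> a ! 0"
    using a by (simp add: nth_eq_iff_index_eq)
  ultimately show ?thesis
    by metis
qed


section \<open>The edge vectors of a representation\<close>

text \<open>Excludes an empty set of fixed vectors, so that being different from \<open>{0}\<close>
  does mean having a nonzero element.\<close>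

lemma zero_fixed:
  assumes "is_rep smul \<pi>" "K \<subseteq> carrier PGL2"
  shows "0 \<in> fixed_vectors \<pi> K"
proof -
  have "\<pi> g 0 = 0" if "g \<in> carrier PGL2" for g
  proof -
    have "Vector_Spaces.linear smul smul (\<pi> g)"
      using assms that by (simp add: is_rep_def)
    then interpret Vector_Spaces.linear smul smul "\<pi> g" .
    show ?thesis
      by (rule zero)
  qed
  then show ?thesis
    using assms(2) by (auto simp: fixed_vectors_def)
qed

lemma fixed_vectors_antimono: "K \<subseteq> L \<Longrightarrow> fixed_vectors \<pi> L \<subseteq> fixed_vectors \<pi> K"
  by (auto simp: fixed_vectors_def)

lemma Gamma0_carrier: "Gamma0 n \<subseteq> carrier PGL2"
  by (auto simp: Gamma0_eq carrier_PGL2 gamma0_mat_invertible)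

text \<open>The definite description in \<open>n_of\<close> calls for existence and uniqueness.
  Without a jump, triviality at level 0 would spread by induction to the level \<open>m\<close> of
  \<open>v\<close>; two different jumps contradict the monotonicity of the fixed spaces.\<close>

lemma fixed_vectors_n_of:
  assumes rep: "is_rep smul \<pi>" and "fixed_vectors \<pi> (Gamma0 0) = {0}"
    and v: "v \<in> fixed_vectors \<pi> (Gamma0 m)" "v \<noteq> 0"
  shows "fixed_vectors \<pi> (Gamma0 (n_of \<pi>)) = {0}"
proof -
  let ?P = "\<lambda>n. fixed_vectors \<pi> (Gamma0 (n + 1)) \<noteq> {0} \<and> fixed_vectors \<pi> (Gamma0 n) = {0}"
  have ex: "\<exists>n. ?P n"
  proof (rule ccontr)
    assume *: "\<nexists>n. ?P n"
    have "fixed_vectors \<pi> (Gamma0 n) = {0}" for n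
      by (induction n) (use assms(2) * in auto)
    then show False
      using v by blast
  qed
  have not_less: "\<not> l < n" if "?P l" "?P n" for l n
  proof
    assume "l < n"
    then have "fixed_vectors \<pi> (Gamma0 (l + 1)) \<subseteq> {0}"
      using conjunct2[OF that(2)] fixed_vectors_antimono[OF Gamma0_antimono[of "l + 1" n], of \<pi>]
      by simp
    then show False
      using that(1) zero_fixed[OF rep Gamma0_carrier[of "l + 1"]] by blast
  qed
  have "\<exists>!n. ?P n"
  proof (rule ex_ex1I[OF ex])
    show "l = n" if "?P l" "?P n" for l n
      using not_less[OF that] not_less[OF that(2,1)] by linarith
  qed
  from theI'[OF this] show ?thesis
    by (simp add: n_of_def)
qed

text \<open>The assumption \<open>no_fixed\<close> records the minimality of the level and is the
  source of harmonicity; \<open>stabilizer\<close> and \<open>base_vector\<close> together make the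
  edge vectors independent of choices.\<close>

locale new_vector =
  fixes smul :: "complex \<Rightarrow> 'v::ab_group_add \<Rightarrow> 'v"
    and \<pi> :: "('f::nonarch_local_field ^ 2 ^ 2) set \<Rightarrow> 'v \<Rightarrow> 'v"
    and a\<^sub>o :: "('f ^ 2) set set list"
    and v\<^sub>o :: 'v
  assumes rep: "is_rep smul \<pi>"
    and base_edge: "a\<^sub>o \<in> graph_edges (n_of \<pi>)"
    and stabilizer: "edge_stabilizer a\<^sub>o = Gamma0 (n_of \<pi> + 1)"
    and base_vector: "v\<^sub>o \<in> fixed_vectors \<pi> (Gamma0 (n_of \<pi> + 1))"
    and no_fixed: "fixed_vectors \<pi> (Gamma0 (n_of \<pi>)) = {0}"
begin

abbreviation vec_at :: "('f ^ 2) set set list \<Rightarrow> 'v" where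
  "vec_at \<equiv> edge_vector \<pi> a\<^sub>o v\<^sub>o"

abbreviation act :: "'f ^ 2 ^ 2 \<Rightarrow> 'v \<Rightarrow> 'v" where
  "act A \<equiv> \<pi> (to_PGL2 A)"

lemma act_linear: "invertible A \<Longrightarrow> Vector_Spaces.linear smul smul (act A)"
  using rep to_PGL2_carrier[of A] by (simp add: is_rep_def)

lemma act_mult: "invertible A \<Longrightarrow> invertible B \<Longrightarrow> act (A ** B) x = act A (act B x)"
  using rep by (simp add: is_rep_def to_PGL2_carrier flip: to_PGL2_mult)

lemma act_one: "act (mat 1) x = x"
  using rep by (simp add: is_rep_def to_PGL2_one)

lemma act_0: "invertible A \<Longrightarrow> act A 0 = 0"
  and act_add: "invertible A \<Longrightarrow> act A (x + y) = act A x + act A y"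
  and act_scale: "invertible A \<Longrightarrow> act A (smul c x) = smul c (act A x)"
  and act_sum: "invertible A \<Longrightarrow> act A (\<Sum>x\<in>E. f x) = (\<Sum>x\<in>E. act A (f x))"
proof -
  assume "invertible A"
  then interpret Vector_Spaces.linear smul smul "act A"
    by (rule act_linear)
  show "act A 0 = 0" "act A (x + y) = act A x + act A y" "act A (smul c x) = smul c (act A x)"
    "act A (\<Sum>x\<in>E. f x) = (\<Sum>x\<in>E. act A (f x))"
    by (rule zero add scale sum)+
qed

lemma base_path: "a\<^sub>o \<in> paths (Suc (n_of \<pi>))"
  using base_edge by (simp add: graph_edges_def)

text \<open>Two matrices that move the base edge to the same edge differ by an element of its
  stabilizer, and this element fixes \<open>v\<^sub>o\<close>.\<close>

lemma vec_at_base: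
  assumes A: "invertible A"
  shows "vec_at (act_path (to_PGL2 A) a\<^sub>o) = act A v\<^sub>o"
  unfolding edge_vector_def
proof (rule the_equality)
  show "\<exists>g\<in>carrier PGL2. act_path (to_PGL2 A) a\<^sub>o = act_path g a\<^sub>o \<and> act A v\<^sub>o = \<pi> g v\<^sub>o"
    using A by blast
next
  fix w
  assume "\<exists>g\<in>carrier PGL2. act_path (to_PGL2 A) a\<^sub>o = act_path g a\<^sub>o \<and> w = \<pi> g v\<^sub>o"
  then obtain B where B: "invertible B" "act_path (to_PGL2 A) a\<^sub>o = act_path (to_PGL2 B) a\<^sub>o"
    "w = act B v\<^sub>o"
    by (auto simp: carrier_PGL2)
  obtain A' where A': "invertible A'" "A ** A' = mat 1" "A' ** A = mat 1"
    using inverse_matrix[OF A] by blast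
  have inv: "invertible (A' ** B)"
    using A' B by (simp add: invertible_mult)
  have "act_path (to_PGL2 (A' ** B)) a\<^sub>o = act_path (to_PGL2 A') (act_path (to_PGL2 A) a\<^sub>o)"
    by (simp add: act_path_mult[OF base_path A'(1) B(1)] B(2))
  also have "\<dots> = a\<^sub>o"
    by (simp add: act_path_one[OF base_path] A' flip: act_path_mult[OF base_path A'(1) A])
  finally have "to_PGL2 (A' ** B) \<in> edge_stabilizer a\<^sub>o"
    using inv by (simp add: edge_stabilizer_def to_PGL2_carrier)
  then have "to_PGL2 (A' ** B) \<in> Gamma0 (n_of \<pi> + 1)"
    by (simp only: stabilizer)
  then have "act (A' ** B) v\<^sub>o = v\<^sub>o"
    using base_vector by (simp add: fixed_vectors_def)
  then have "act (A ** (A' ** B)) v\<^sub>o = act A v\<^sub>o"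
    by (simp add: act_mult[OF A inv])
  then show "w = act A v\<^sub>o"
    by (simp add: matrix_mul_assoc A' B)
qed

lemma vec_at_act:
  assumes A: "invertible A" and a: "a \<in> graph_edges (n_of \<pi>)"
  shows "vec_at (act_path (to_PGL2 A) a) = act A (vec_at a)"
proof -
  obtain B where B: "invertible B" "a = act_path (to_PGL2 B) a\<^sub>o"
    using paths_act_eq[OF base_path] a unfolding graph_edges_def by blast
  show ?thesis
    using vec_at_base[of "A ** B"] vec_at_base[of B] A B
    by (simp add: act_path_mult[OF base_path] act_mult invertible_mult)
qed

text \<open>Stated for any finite set of edges preserved by the stabilizer of \<open>s\<close>, so
  as to cover the edges with head \<open>s\<close> and those with tail \<open>s\<close> at
  once.\<close>

lemma sum_vec_at_eq_0:
  assumes fin: "finite E" and E: "E \<subseteq> graph_edges (n_of \<pi>)" and s: "s \<in> paths (n_of \<pi>)"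
    and inv: "\<And>A. invertible A \<Longrightarrow> act_path (to_PGL2 A) s = s \<Longrightarrow> act_path (to_PGL2 A) ` E \<subseteq> E"
  shows "(\<Sum>a\<in>E. vec_at a) = 0"
proof -
  define S where "S = (\<Sum>a\<in>E. vec_at a)"
  have S_fixed: "act A S = S" if A: "invertible A" "act_path (to_PGL2 A) s = s" for A
  proof -
    have inj: "inj_on (act_path (to_PGL2 A)) E"
      using E inj_on_act_path[OF A(1)] inj_on_subset unfolding graph_edges_def by blast
    \<comment> \<open>Finiteness turns an injection of \<open>E\<close> into itself into a
      permutation.\<close>
    have "act_path (to_PGL2 A) ` E = E"
      using inv[OF A] inj fin by (simp add: endo_inj_surj)
    then have "S = (\<Sum>a\<in>E. vec_at (act_path (to_PGL2 A) a))"
      unfolding S_def using sum.reindex[OF inj, of vec_at] by simp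
    also have "\<dots> = (\<Sum>a\<in>E. act A (vec_at a))"
      using E A(1) by (intro sum.cong) (auto simp: vec_at_act)
    also have "\<dots> = act A S"
      by (simp add: S_def act_sum A(1))
    finally show ?thesis
      by simp
  qed
  obtain g where g: "invertible g" "s = path_of g (n_of \<pi>)"
    using paths_eq_path_of[OF s] by blast
  obtain g' where g': "invertible g'" "g ** g' = mat 1" "g' ** g = mat 1"
    using inverse_matrix[OF g(1)] by blast
  \<comment> \<open>Since \<open>U\<close> fixes the standard path, its conjugate by
    \<open>g\<close> fixes \<open>s\<close> and therefore \<open>S\<close>. Transported back by
    \<open>g'\<close>, this is invariance under \<open>U\<close> itself.\<close>
  have "act U (act g' S) = act g' S" if U: "U \<in> gamma0_mat (n_of \<pi>)" for U
  proof -
    note iU = gamma0_mat_invertible[OF U]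
    have iA: "invertible (g ** U ** g')"
      by (intro invertible_mult g g' iU)
    have "g ** U ** g' ** g = g ** U"
      by (simp add: g' flip: matrix_mul_assoc)
    then have "act_path (to_PGL2 (g ** U ** g')) s = s"
      by (simp add: g act_path_of path_of_mult_gamma0[OF U])
    then have "act g' S = act g' (act (g ** U ** g') S)"
      using S_fixed[OF iA] by simp
    also have "\<dots> = act (g' ** (g ** U ** g')) S"
      by (rule act_mult[symmetric, OF g'(1) iA])
    also have "g' ** (g ** U ** g') = U ** g'"
      by (simp add: g' matrix_mul_assoc)
    also have "act (U ** g') S = act U (act g' S)"
      by (rule act_mult[OF iU g'(1)])
    finally show ?thesis
      by simp
  qed
  then have "act g' S \<in> fixed_vectors \<pi> (Gamma0 (n_of \<pi>))"
    by (auto simp: fixed_vectors_def Gamma0_eq)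
  then have "act g' S = 0"
    using no_fixed by simp
  have "S = act (g ** g') S"
    by (simp add: g' act_one)
  also have "\<dots> = act g (act g' S)"
    by (rule act_mult[OF g(1) g'(1)])
  also have "\<dots> = 0"
    using \<open>act g' S = 0\<close> act_0 g(1) by simp
  finally show ?thesis
    by (simp add: S_def)
qed

lemma sum_head_tail_eq_0:
  assumes s: "s \<in> graph_verts (n_of \<pi>)"
  shows "finite {a \<in> graph_edges (n_of \<pi>). edge_head a = s} \<Longrightarrow>
      (\<Sum>a | a \<in> graph_edges (n_of \<pi>) \<and> edge_head a = s. vec_at a) = 0"
    and "finite {a \<in> graph_edges (n_of \<pi>). edge_tail a = s} \<Longrightarrow>
      (\<Sum>a | a \<in> graph_edges (n_of \<pi>) \<and> edge_tail a = s. vec_at a) = 0"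
  using s by (auto simp: graph_verts_def graph_edges_def edge_head_act edge_tail_act
      intro!: sum_vec_at_eq_0[where s = s] act_path_closed)

section \<open>Harmonicity, smoothness and injectivity\<close>

lemma Psi_harmonic:
  assumes \<phi>: "Vector_Spaces.linear smul (*) \<phi>"
  shows "Psi \<pi> a\<^sub>o v\<^sub>o \<phi> \<in> harmonic_forms (n_of \<pi>)"
proof -
  interpret \<phi>: Vector_Spaces.linear smul "(*)" \<phi>
    by (rule \<phi>)
  let ?n = "n_of \<pi>"
  have "dstar ?n (Psi \<pi> a\<^sub>o v\<^sub>o \<phi>) s = 0" if s: "s \<in> graph_verts ?n" for s
  proof -
    let ?H = "{a \<in> graph_edges ?n. edge_head a = s}"
    let ?T = "{a \<in> graph_edges ?n. edge_tail a = s}"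
    let ?f = "\<lambda>a. incidence a s * Psi \<pi> a\<^sub>o v\<^sub>o \<phi> a"
    have eq: "dstar ?n (Psi \<pi> a\<^sub>o v\<^sub>o \<phi>) s = sum ?f (?H \<union> ?T)"
      unfolding dstar_def by (rule sum.cong) auto
    show ?thesis
    proof (cases "finite ?H \<and> finite ?T")
      case True
      have "?H \<inter> ?T = {}"
        by (auto dest: edge_head_neq_tail)
      then have "sum ?f (?H \<union> ?T) = sum ?f ?H + sum ?f ?T"
        using True by (intro sum.union_disjoint) auto
      also have "sum ?f ?H = (\<Sum>a\<in>?H. \<phi> (vec_at a))"
        by (intro sum.cong) (auto simp: incidence_def Psi_def)
      also have "\<dots> = \<phi> (\<Sum>a\<in>?H. vec_at a)"
        by (rule \<phi>.sum[symmetric])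
      also have "\<dots> = 0"
        using sum_head_tail_eq_0(1)[OF s] True by (simp add: \<phi>.zero)
      also have "sum ?f ?T = (\<Sum>a\<in>?T. - \<phi> (vec_at a))"
        by (intro sum.cong) (auto simp: incidence_def Psi_def dest: edge_head_neq_tail)
      also have "\<dots> = - \<phi> (\<Sum>a\<in>?T. vec_at a)"
        by (simp add: sum_negf \<phi>.sum)
      also have "\<dots> = 0"
        using sum_head_tail_eq_0(2)[OF s] True by (simp add: \<phi>.zero)
      finally show ?thesis
        using eq by simp
    next
      case False \<comment> \<open>the junk value \<open>0\<close> of an infinite sum\<close>
      then show ?thesis
        unfolding eq by (simp add: sum.infinite)
    qed
  qed
  then show ?thesis
    by (simp add: harmonic_forms_def edge_cochains_def Psi_def)
qed

text \<open>By equivariance of the edge vectors, an open subgroup that fixes the form also fixes its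
  image.\<close>

lemma Psi_smooth:
  assumes "smooth_vector (dual_action \<pi>) \<phi>"
  shows "smooth_vector (cochain_action (n_of \<pi>)) (Psi \<pi> a\<^sub>o v\<^sub>o \<phi>)"
proof -
  obtain K where K: "open_subgroup K" "\<forall>k\<in>K. dual_action \<pi> k \<phi> = \<phi>"
    using assms unfolding smooth_vector_def by blast
  have "cochain_action (n_of \<pi>) k (Psi \<pi> a\<^sub>o v\<^sub>o \<phi>) = Psi \<pi> a\<^sub>o v\<^sub>o \<phi>" if k: "k \<in> K" for k
  proof
    fix a
    interpret group "PGL2 :: ('f ^ 2 ^ 2) set monoid"
      by (rule group_PGL2)
    have "subgroup K PGL2"
      using K(1) by (simp add: open_subgroup_def)
    then have "k \<in> carrier PGL2"
      using k by (rule subgroup.mem_carrier)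
    then have "inv\<^bsub>PGL2\<^esub> k \<in> to_PGL2 ` {A. invertible A}"
      by (simp flip: carrier_PGL2)
    then obtain B where B: "invertible B" "inv\<^bsub>PGL2\<^esub> k = to_PGL2 B"
      by auto
    show "cochain_action (n_of \<pi>) k (Psi \<pi> a\<^sub>o v\<^sub>o \<phi>) a = Psi \<pi> a\<^sub>o v\<^sub>o \<phi> a"
    proof (cases "a \<in> graph_edges (n_of \<pi>)")
      case True
      then have "act_path (to_PGL2 B) a \<in> graph_edges (n_of \<pi>)"
        using act_path_closed[OF B(1)] by (simp add: graph_edges_def)
      then have "cochain_action (n_of \<pi>) k (Psi \<pi> a\<^sub>o v\<^sub>o \<phi>) a = \<phi> (act B (vec_at a))"
        using True by (simp add: cochain_action_def Psi_def B vec_at_act)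
      also have "\<dots> = dual_action \<pi> k \<phi> (vec_at a)"
        by (simp add: dual_action_def B)
      also have "\<dots> = Psi \<pi> a\<^sub>o v\<^sub>o \<phi> a"
        using True K(2) k by (simp add: Psi_def)
      finally show ?thesis .
    qed (simp add: cochain_action_def Psi_def)
  qed
  then show ?thesis
    using K(1) unfolding smooth_vector_def by blast
qed

lemma Psi_inj:
  assumes irred: "is_irreducible smul \<pi>" and "v\<^sub>o \<noteq> 0"
    and \<phi>: "Vector_Spaces.linear smul (*) \<phi>" and \<psi>: "Vector_Spaces.linear smul (*) \<psi>"
    and eq: "Psi \<pi> a\<^sub>o v\<^sub>o \<phi> = Psi \<pi> a\<^sub>o v\<^sub>o \<psi>"
  shows "\<phi> = \<psi>"
proof -
  interpret \<phi>: Vector_Spaces.linear smul "(*)" \<phi>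
    by (rule \<phi>)
  interpret \<psi>: Vector_Spaces.linear smul "(*)" \<psi>
    by (rule \<psi>)
  \<comment> \<open>Testing on all translates of \<open>w\<close> builds invariance under the group
    into the definition.\<close>
  define W where "W = {w. \<forall>A. invertible A \<longrightarrow> \<phi> (act A w) = \<psi> (act A w)}"
  have sub: "\<phi>.vs1.subspace W"
  proof (rule \<phi>.vs1.subspaceI)
    show "0 \<in> W"
      by (simp add: W_def act_0 \<phi>.zero \<psi>.zero)
    show "x + y \<in> W" if "x \<in> W" "y \<in> W" for x y
      using that by (simp add: W_def act_add \<phi>.add \<psi>.add)
    show "smul c x \<in> W" if "x \<in> W" for c x
      using that by (simp add: W_def act_scale \<phi>.scale \<psi>.scale)
  qed
  have invariant: "\<pi> g ` W \<subseteq> W" if g: "g \<in> carrier PGL2" for g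
  proof -
    obtain B where "invertible B" "g = to_PGL2 B"
      using g unfolding carrier_PGL2 by blast
    then show ?thesis
      by (auto simp: W_def invertible_mult simp flip: act_mult)
  qed
  have "v\<^sub>o \<in> W"
    unfolding W_def
  proof (intro CollectI allI impI)
    fix A :: "'f ^ 2 ^ 2"
    assume A: "invertible A"
    have "act_path (to_PGL2 A) a\<^sub>o \<in> graph_edges (n_of \<pi>)"
      using act_path_closed[OF A base_path] by (simp add: graph_edges_def)
    then show "\<phi> (act A v\<^sub>o) = \<psi> (act A v\<^sub>o)"
      using fun_cong[OF eq, of "act_path (to_PGL2 A) a\<^sub>o"] by (simp add: Psi_def vec_at_base A)
  qed
  then have "W \<noteq> {0}"
    using \<open>v\<^sub>o \<noteq> 0\<close> by blast
  then have "W = UNIV"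
    using irred sub invariant unfolding is_irreducible_def by blast
  then have "\<phi> (act (mat 1) x) = \<psi> (act (mat 1) x)" for x
    using invertible_one unfolding W_def by blast
  then show ?thesis
    by (simp add: act_one fun_eq_iff)
qed

end

theorem mainTheorem5:
  fixes smul :: "complex \<Rightarrow> 'v::ab_group_add \<Rightarrow> 'v"
    and \<pi> :: "('f::nonarch_local_field ^ 2 ^ 2) set \<Rightarrow> 'v \<Rightarrow> 'v"
    and a\<^sub>o :: "('f ^ 2) set set list"
    and v\<^sub>o :: 'v
  assumes "is_smooth_rep smul \<pi>"
    and "is_irreducible smul \<pi>"
    and "fixed_vectors \<pi> (Gamma0 0) = {0}"
    and "is_generic smul \<pi>"
    and "a\<^sub>o \<in> graph_edges (n_of \<pi>)"
    and "edge_stabilizer a\<^sub>o = Gamma0 (n_of \<pi> + 1)"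
    and "v\<^sub>o \<in> fixed_vectors \<pi> (Gamma0 (n_of \<pi> + 1))"
    and "v\<^sub>o \<noteq> 0"
  shows "Psi \<pi> a\<^sub>o v\<^sub>o ` contragredient smul \<pi> \<subseteq> smooth_harmonic_forms (n_of \<pi>) \<and>
         inj_on (Psi \<pi> a\<^sub>o v\<^sub>o) (contragredient smul \<pi>)"
proof -
  have rep: "is_rep smul \<pi>"
    using assms(1) by (simp add: is_smooth_rep_def)
  \<comment> \<open>The level lemma is used with m = \<open>n_of \<pi> + 1\<close>: whatever number
    the description denotes, \<open>v\<^sub>o\<close> is a nonzero vector fixed at that level, so
    the argument is not circular.\<close>
  interpret new_vector smul \<pi> a\<^sub>o v\<^sub>o
    using rep assms(5-7) fixed_vectors_n_of[OF rep assms(3,7,8)] by unfold_locales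
  have "Psi \<pi> a\<^sub>o v\<^sub>o \<phi> \<in> smooth_harmonic_forms (n_of \<pi>)" if "\<phi> \<in> contragredient smul \<pi>" for \<phi>
    using that Psi_harmonic Psi_smooth by (simp add: contragredient_def smooth_harmonic_forms_def)
  moreover have "inj_on (Psi \<pi> a\<^sub>o v\<^sub>o) (contragredient smul \<pi>)"
    using Psi_inj[OF assms(2,8)] by (intro inj_onI) (simp add: contragredient_def)
  ultimately show ?thesis
    by blast
qed

end
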